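(* Let $b\ge 2$ be an integer and let $\phi:\mathbb{R}\to\mathbb{R}$ satisfy the following: (H1) $\phi$ is periodic with period $1$ and vanishes on $\mathbb{Z}$; (H2) $\phi$ is continuous and its restriction to $[0,1]$ is piecewise continuously differentiable; (H3) $\int_0^1\phi(t)e^{-2\pi \mathrm{i} jbt}\,dt=0$ for all $j\in\mathbb{Z}\setminus\{0\}$. Let $f:[0,1]\to\mathbb{R}$ be given by $f(t):=\sum_{m=0}^\infty b^{-m}\phi(b^m t)$, and let $\Theta:[0,1)\to[0,\infty)$ be given by $\Theta(0):=0$ and $\Theta(x):=x/\sqrt{-\ln x}$ for $x\in(0,1)$. Then the continuous $\Theta$-variation function of $f$ along the sequence of $b$-adic partitions exists and is given by $$\langle f\rangle^{\Theta}(t)=t\cdot\sqrt{\frac{2}{\pi\ln(b)}\int_0^1(\phi'(x))^2\,dx},\qquad t\in[0,1].$$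
   Context: Piecewise continuously differentiable: a function $\phi:[0,1]\to\mathbb{R}$ is piecewise continuously differentiable if there are at most finitely many points $0<t_1<\dots<t_k<1$ ($k\ge 0$) such that $\phi$ is continuously differentiable except at $t_1,\dots,t_k$, and the one-sided limits $\phi'(t_\ell-)$, $\phi'(t_\ell+)$ ($\ell=1,\dots,k$), $\phi'(0+)$ and $\phi'(1-)$ exist in $\mathbb{R}$. In the integral, $\phi'$ is given arbitrary real values at the exceptional points (the integral does not depend on them). Continuous $\Theta$-variation function: let $f:[0,1]\to\mathbb{R}$ be continuous, extended by $f(t):=f(1)$ for $t>1$. For $n\in\mathbb{N}$ and $t\in[0,1]$ put $$V^{\Theta,t}_n(f):=\sum_{j=0}^{\lfloor tb^n\rfloor}\Theta\big(|f((j+1)b^{-n})-f(jb^{-n})|\big),$$ which is well-defined for all sufficiently large $n$, since by uniform continuity of $f$ all the increments are then less than $1$ in absolute value. If there is a continuous function $\langle f\rangle^\Theta:[0,1]\to[0,\infty)$ such that $V^{\Theta,t}_n(f)\to\langle f\rangle^\Theta(t)$ as $n\to\infty$ for all $t\in[0,1]$, then $\langle f\rangle^\Theta$ is called the continuous $\Theta$-variation function of $f$ along the sequence of $b$-adic partitions $\Pi_n=\{jb^{-n}:j=0,1,\dots,b^n\}$, $n\in\mathbb{N}$. *)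

theory Defs
  imports "HOL-Analysis.Analysis"
begin

(* Only interior points occur, where deriv depends on the restriction to [0,1] alone. For
   functions continuous on [0,1], as in the theorem, one-sided continuous differentiability
   at 0 and 1 is automatic from the last two limits. The library's
   piecewise_C1_differentiable_on does not ask for one-sided limits of the derivative. *)
definition piecewise_cont_differentiable :: "(real \<Rightarrow> real) \<Rightarrow> bool" where
  "piecewise_cont_differentiable \<phi> \<longleftrightarrow>
    (\<exists>T. finite T \<and> T \<subseteq> {0<..<1} \<and>
      (\<forall>x\<in>{0<..<1} - T. \<phi> differentiable (at x)) \<and>
      continuous_on ({0<..<1} - T) (deriv \<phi>) \<and>
      (\<forall>t\<in>T. (\<exists>l. (deriv \<phi> \<longlongrightarrow> l) (at_left t)) \<and> (\<exists>r. (deriv \<phi> \<longlongrightarrow> r) (at_right t))) \<and>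
      (\<exists>r. (deriv \<phi> \<longlongrightarrow> r) (at_right 0)) \<and>
      (\<exists>l. (deriv \<phi> \<longlongrightarrow> l) (at_left 1)))"

(* The intended domain is [0,1); values elsewhere are irrelevant. *)
definition Theta :: "real \<Rightarrow> real" where
  "Theta x = (if x = 0 then 0 else x / sqrt (- ln x))"

(* Encodes the convention f(t) = f(1) for t > 1. *)
definition extend_const :: "(real \<Rightarrow> real) \<Rightarrow> real \<Rightarrow> real" where
  "extend_const f t = (if t \<le> 1 then f t else f 1)"

(* For continuous f, an increment can reach 1 in absolute value, and so leave the domain of
   Theta, for finitely many n only; such n do not affect the limit taken below. *)
definition variation_sum ::
  "(real \<Rightarrow> real) \<Rightarrow> nat \<Rightarrow> (real \<Rightarrow> real) \<Rightarrow> nat \<Rightarrow> real \<Rightarrow> real" where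
  "variation_sum \<Theta> b f n t =
    (\<Sum>j = 0..nat \<lfloor>t * real b ^ n\<rfloor>.
      \<Theta> \<bar>extend_const f ((real j + 1) / real b ^ n) - extend_const f (real j / real b ^ n)\<bar>)"

definition is_continuous_variation ::
  "(real \<Rightarrow> real) \<Rightarrow> nat \<Rightarrow> (real \<Rightarrow> real) \<Rightarrow> (real \<Rightarrow> real) \<Rightarrow> bool" where
  "is_continuous_variation \<Theta> b f v \<longleftrightarrow>
    continuous_on {0..1} f \<and>
    continuous_on {0..1} v \<and>
    (\<forall>t\<in>{0..1}. 0 \<le> v t) \<and>
    (\<forall>t\<in>{0..1}. (\<lambda>n. variation_sum \<Theta> b f n t) \<longlonglongrightarrow> v t)"

definition takagi_type :: "nat \<Rightarrow> (real \<Rightarrow> real) \<Rightarrow> real \<Rightarrow> real" where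
  "takagi_type b \<phi> t = (\<Sum>m. \<phi> (real b ^ m * t) / real b ^ m)"

end

theory Submission
  imports Defs "HOL-Probability.Levy" "HOL-Probability.Probability_Mass_Function"
begin

text \<open>Since \<open>\<phi>\<close> vanishes on the integers, the increment of f over the j-th b-adic interval
  of level n is \<open>b\<^sup>-\<^sup>n\<close> times the sum S of the slopes of \<open>\<phi>\<close> over the first n levels, the k-th
  of which depends only on the k lowest digits of j. Hypothesis (H3) says that
  \<open>\<Sum>i<b. \<phi> ((x + i) / b)\<close> is constant in x, hence for uniformly random digits the slopes are
  bounded martingale differences. Their squares satisfy a law of large numbers because the
  conditional means of the squares are Riemann sums of the integral of \<open>\<phi>'\<^sup>2\<close>. McLeish's product
  argument then gives the central limit theorem, so the mean of \<open>\<bar>S\<bar> / sqrt n\<close> tends to the first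
  absolute moment of a normal distribution. Finally \<open>\<Theta>\<close> is asymptotically linear at scale
  \<open>b\<^sup>-\<^sup>n\<close> with factor \<open>1 / sqrt (n ln b)\<close>, and fixing the highest digits of j changes S only
  by a bounded amount, which yields linearity in t.\<close>

section \<open>Martingale differences in base b\<close>

text \<open>The k-th slope depends on all k lowest digits, so the summands of S are in general
  dependent and a central limit theorem for independent variables does not apply. In McLeish's
  argument exp (i s S / sqrt n) is compared with the product of the factors (1 + i y) exp (- y^2 /
  2), where y = s X / sqrt n. The martingale property gives the product of the 1 + i y mean exactly
  1, and the law of large numbers makes the sum of the y^2 almost deterministic, so the Gaussian
  characteristic function appears.

  Convergence in distribution alone does not carry over to the mean of an unbounded function.
  Orthogonality of the differences bounds the mean of S^2 by n M^2, which controls the truncation of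
  the absolute value.

  The factor ln b comes from - ln (|S| / b^n) = n ln b - ln |S|. Since |S| <= n M, the last
  logarithm is of order at most ln n, except that it is very negative for tiny |S|; there the factor
  |S| itself makes the term harmless.

  The time t restricts the highest digits of j, while the martingale is driven by the lowest ones,
  which still range over full periods.\<close>

definition avg :: "nat \<Rightarrow> (nat \<Rightarrow> 'a::real_normed_field) \<Rightarrow> 'a" where
  "avg N g = (\<Sum>j<N. g j) / of_nat N"

lemma sum_lessThan_mult:
  fixes g :: "nat \<Rightarrow> 'a::comm_monoid_add"
  shows "(\<Sum>j<m * n. g j) = (\<Sum>a<m. \<Sum>q<n. g (a + m * q))"
proof -
  have "(\<Sum>j<m * n. g j) = (\<Sum>q<n. sum g {q * m..<q * m + m})"
    by (simp add: sum.nat_group mult.commute)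
  also have "\<dots> = (\<Sum>q<n. \<Sum>a<m. g (a + m * q))"
  proof (rule sum.cong[OF refl])
    fix q
    have "sum g {q * m..<q * m + m} = sum g {0 + q * m..<m + q * m}" by (simp add: add.commute)
    also have "\<dots> = (\<Sum>a<m. g (a + m * q))"
      by (subst sum.shift_bounds_nat_ivl) (simp add: lessThan_atLeast0 mult.commute)
    finally show "sum g {q * m..<q * m + m} = (\<Sum>a<m. g (a + m * q))" .
  qed
  finally show ?thesis by (simp add: sum.swap[of _ "{..<n}"])
qed

text \<open>The tower property. For m = b^k the number j = a + m * q has low digits a and high
  digits q, so the inner average is the conditional expectation given the k lowest digits.\<close>

lemma avg_mult: "avg (m * n) g = avg m (\<lambda>a. avg n (\<lambda>q. g (a + m * q)))"
  by (simp add: avg_def sum_lessThan_mult sum_divide_distrib[symmetric] mult.commute)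

lemma avg_const [simp]: "N > 0 \<Longrightarrow> avg N (\<lambda>_. c) = c"
  by (simp add: avg_def)

lemma avg_periodic:
  assumes "n > 0" and "\<And>a q. a < m \<Longrightarrow> g (a + m * q) = g a"
  shows "avg (m * n) g = avg m g"
  using assms by (simp add: avg_mult) (simp add: avg_def)

lemma avg_cmult: "avg N (\<lambda>j. c * g j) = c * avg N g"
  by (simp add: avg_def sum_distrib_left)

lemma avg_add: "avg N (\<lambda>j. f j + g j) = avg N f + avg N g"
  by (simp add: avg_def sum.distrib add_divide_distrib)

lemma avg_diff: "avg N (\<lambda>j. f j - g j) = avg N f - avg N g"
  by (simp add: avg_def sum_subtractf diff_divide_distrib)

lemma avg_sum: "avg N (\<lambda>j. \<Sum>i\<in>I. f i j) = (\<Sum>i\<in>I. avg N (f i))"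
  by (simp add: avg_def sum_divide_distrib[symmetric]) (simp add: sum.swap[of _ _ I])

lemma avg_cong: "(\<And>j. j < N \<Longrightarrow> f j = g j) \<Longrightarrow> avg N f = avg N g"
  by (simp add: avg_def)

lemma avg_mono:
  fixes f g :: "nat \<Rightarrow> real"
  shows "(\<And>j. j < N \<Longrightarrow> f j \<le> g j) \<Longrightarrow> avg N f \<le> avg N g"
  unfolding avg_def by (intro divide_right_mono sum_mono) auto

lemma avg_nonneg:
  fixes f :: "nat \<Rightarrow> real"
  shows "(\<And>j. j < N \<Longrightarrow> 0 \<le> f j) \<Longrightarrow> 0 \<le> avg N f"
  unfolding avg_def by (intro divide_nonneg_nonneg sum_nonneg) auto

lemma norm_avg_le: "norm (avg N g) \<le> avg N (\<lambda>j. norm (g j))"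
  unfolding avg_def by (simp add: norm_divide divide_right_mono norm_sum)

lemma norm_avg_bound:
  assumes "N > 0" and "\<And>j. j < N \<Longrightarrow> norm (g j) \<le> B"
  shows "norm (avg N g) \<le> B"
  using order_trans[OF norm_avg_le avg_mono[of N _ "\<lambda>_. B"]] assms by auto

lemma avg_power2_le:
  fixes f :: "nat \<Rightarrow> real"
  assumes "N > 0"
  shows "(avg N f)\<^sup>2 \<le> avg N (\<lambda>j. (f j)\<^sup>2)"
proof -
  have "(\<Sum>j<N. f j)\<^sup>2 \<le> real N * (\<Sum>j<N. (f j)\<^sup>2)"
    using sum_squared_le_sum_of_squares[of f "{..<N}"] by (simp add: mult.commute)
  then show ?thesis
    using assms by (simp add: avg_def power_divide field_simps power2_eq_square)
qed

text \<open>The filtration is by low digits of j. \<open>X_periodic\<close> is adaptedness,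
  \<open>X_martingale\<close> averages over the one new digit q, and \<open>X_square\<close> is the
  conditional mean of a square r levels later, with an error uniform in the past k, a. This
  uniformity is what the covariance estimate uses.\<close>

locale adic_martingale =
  fixes b :: nat and X :: "nat \<Rightarrow> nat \<Rightarrow> real" and M v :: real
  assumes b_pos: "b > 0"
    and X_periodic: "X k (j + b ^ k * q) = X k j"
    and X_bound: "\<bar>X k j\<bar> \<le> M"
    and X_martingale: "a < b ^ k \<Longrightarrow> (\<Sum>q<b. X (Suc k) (a + b ^ k * q)) = 0"
    and X_square: "\<epsilon> > 0 \<Longrightarrow>
      \<exists>R. \<forall>k. \<forall>r\<ge>R. \<forall>a<b ^ k. \<bar>avg (b ^ r) (\<lambda>q. (X (k + r) (a + b ^ k * q))\<^sup>2) - v\<bar> \<le> \<epsilon>"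
begin

lemma M_nonneg: "M \<ge> 0"
  using X_bound[of 0 0] by linarith

lemma X_periodic_le:
  assumes "k \<le> l"
  shows "X k (j + b ^ l * q) = X k j"
proof -
  have "b ^ l * q = b ^ k * (b ^ (l - k) * q)" using assms by (simp add: power_add[symmetric])
  then show ?thesis by (metis X_periodic)
qed

lemma avg_adic:
  assumes "l \<le> n" and "\<And>a q. g (a + b ^ l * q) = g a"
  shows "avg (b ^ n) g = avg (b ^ l) g"
proof -
  have "b ^ n = b ^ l * b ^ (n - l)" using assms by (simp add: power_add[symmetric])
  then show ?thesis using avg_periodic[of "b ^ (n - l)" "b ^ l" g] assms b_pos by simp
qed

text \<open>Unlike the X k themselves, the centred squares need not be martingale differences: their
  conditional mean is known to be small only after many fresh digits.\<close>

definition Z :: "nat \<Rightarrow> nat \<Rightarrow> real" where "Z k j = (X k j)\<^sup>2 - v"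

lemma Z_periodic_le: "k \<le> l \<Longrightarrow> Z k (j + b ^ l * q) = Z k j"
  by (simp add: Z_def X_periodic_le)

lemma X_square_le: "(X k j)\<^sup>2 \<le> M\<^sup>2"
  using power_mono[OF X_bound[of k j] abs_ge_zero, of 2] by simp

lemma Z_bound: "\<bar>Z k j\<bar> \<le> M\<^sup>2 + \<bar>v\<bar>"
  unfolding Z_def using X_square_le[of k j] zero_le_power2[of "X k j"] by linarith

text \<open>Given the k lowest digits, Z k is a constant and can be pulled out; what remains is the
  mean of Z l over the l - k fresh digits, which \<open>X_square\<close> bounds by
  \<epsilon>.\<close>

lemma Z_covariance:
  assumes R: "\<forall>k. \<forall>r\<ge>R. \<forall>a<b ^ k. \<bar>avg (b ^ r) (\<lambda>q. (X (k + r) (a + b ^ k * q))\<^sup>2) - v\<bar> \<le> \<epsilon>"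
    and kl: "k + R \<le> l" "l \<le> n"
  shows "\<bar>avg (b ^ n) (\<lambda>j. Z k j * Z l j)\<bar> \<le> (M\<^sup>2 + \<bar>v\<bar>) * \<epsilon>"
proof -
  define r where "r = l - k"
  have l: "l = k + r" "r \<ge> R" using kl by (auto simp: r_def)
  have "avg (b ^ n) (\<lambda>j. Z k j * Z l j) = avg (b ^ l) (\<lambda>j. Z k j * Z l j)"
    using kl by (intro avg_adic) (auto simp: Z_periodic_le)
  also have "\<dots> = avg (b ^ k) (\<lambda>a. Z k a * avg (b ^ r) (\<lambda>q. Z l (a + b ^ k * q)))"
    unfolding l power_add by (simp add: avg_mult Z_periodic_le avg_cmult)
  finally have eq: "avg (b ^ n) (\<lambda>j. Z k j * Z l j) =
      avg (b ^ k) (\<lambda>a. Z k a * avg (b ^ r) (\<lambda>q. Z l (a + b ^ k * q)))" .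
  have "\<bar>Z k a * avg (b ^ r) (\<lambda>q. Z l (a + b ^ k * q))\<bar> \<le> (M\<^sup>2 + \<bar>v\<bar>) * \<epsilon>" if "a < b ^ k" for a
  proof -
    have "\<bar>avg (b ^ r) (\<lambda>q. Z l (a + b ^ k * q))\<bar> \<le> \<epsilon>"
      using R l that b_pos by (simp add: Z_def avg_diff)
    then show ?thesis unfolding abs_mult by (intro mult_mono Z_bound) auto
  qed
  then have "norm (avg (b ^ k) (\<lambda>a. Z k a * avg (b ^ r) (\<lambda>q. Z l (a + b ^ k * q)))) \<le> (M\<^sup>2 + \<bar>v\<bar>) * \<epsilon>"
    using b_pos by (intro norm_avg_bound) auto
  then show ?thesis unfolding eq by simp
qed

text \<open>Expand the square. Pairs of levels at distance at least R are almost uncorrelated and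
  give the quadratic term with the small factor \<epsilon>; each level has at most 2 R closer
  partners, for which the trivial bound yields only a linear term.\<close>

lemma sum_Z_second_moment:
  assumes R: "\<forall>k. \<forall>r\<ge>R. \<forall>a<b ^ k. \<bar>avg (b ^ r) (\<lambda>q. (X (k + r) (a + b ^ k * q))\<^sup>2) - v\<bar> \<le> \<epsilon>"
    and \<epsilon>: "\<epsilon> \<ge> 0"
  shows "avg (b ^ n) (\<lambda>j. (\<Sum>k<n. Z (Suc k) j)\<^sup>2) \<le>
    (M\<^sup>2 + \<bar>v\<bar>) * \<epsilon> * (real n)\<^sup>2 + 2 * real R * (M\<^sup>2 + \<bar>v\<bar>)\<^sup>2 * real n"
proof -
  let ?B = "M\<^sup>2 + \<bar>v\<bar>"
  have B: "?B \<ge> 0" by simp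
  let ?c = "\<lambda>k l. avg (b ^ n) (\<lambda>j. Z (Suc k) j * Z (Suc l) j)"
  have c: "?c k l \<le> ?B * \<epsilon> + (if k < l + R \<and> l < k + R then ?B\<^sup>2 else 0)" if "k < n" "l < n" for k l
  proof -
    consider "k + R \<le> l" | "l + R \<le> k" | "k < l + R \<and> l < k + R" by linarith
    then show ?thesis
    proof cases
      case 1
      then show ?thesis using Z_covariance[OF R, of "Suc k" "Suc l" n] that by auto
    next
      case 2
      then show ?thesis using Z_covariance[OF R, of "Suc l" "Suc k" n] that by (auto simp: mult.commute)
    next
      case 3
      have "norm (?c k l) \<le> ?B * ?B"
        using b_pos B by (intro norm_avg_bound) (auto simp: abs_mult intro!: mult_mono Z_bound)
      then have "?c k l \<le> ?B\<^sup>2" by (simp add: power2_eq_square)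
      moreover have "0 \<le> ?B * \<epsilon>" using B \<epsilon> by (rule mult_nonneg_nonneg)
      ultimately show ?thesis using 3 by simp
    qed
  qed
  have "avg (b ^ n) (\<lambda>j. (\<Sum>k<n. Z (Suc k) j)\<^sup>2) = (\<Sum>k<n. \<Sum>l<n. ?c k l)"
    by (simp add: power2_eq_square sum_product avg_sum)
  also have "\<dots> \<le> (\<Sum>k<n. \<Sum>l<n. ?B * \<epsilon> + (if k < l + R \<and> l < k + R then ?B\<^sup>2 else 0))"
    by (intro sum_mono c) auto
  also have "\<dots> = ?B * \<epsilon> * (real n)\<^sup>2 + (\<Sum>k<n. \<Sum>l<n. if k < l + R \<and> l < k + R then ?B\<^sup>2 else 0)"
    by (simp add: sum.distrib power2_eq_square)
  also have "(\<Sum>k<n. \<Sum>l<n. if k < l + R \<and> l < k + R then ?B\<^sup>2 else 0) \<le> (\<Sum>k<n. 2 * real R * ?B\<^sup>2)"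
  proof (rule sum_mono)
    fix k
    have "(\<Sum>l<n. if k < l + R \<and> l < k + R then ?B\<^sup>2 else 0) =
        real (card {l\<in>{..<n}. k < l + R \<and> l < k + R}) * ?B\<^sup>2"
      by (subst sum.inter_filter[symmetric]) auto
    also have "\<dots> \<le> real (2 * R) * ?B\<^sup>2"
    proof -
      have "card {l\<in>{..<n}. k < l + R \<and> l < k + R} \<le> card {k - R..<k + R}"
        by (rule card_mono) auto
      then show ?thesis by (intro mult_right_mono) (auto simp del: of_nat_mult)
    qed
    finally show "(\<Sum>l<n. if k < l + R \<and> l < k + R then ?B\<^sup>2 else 0) \<le> 2 * real R * ?B\<^sup>2" by simp
  qed
  finally show ?thesis by (simp add: algebra_simps)
qed

text \<open>After division by n^2 only the \<epsilon> term of the second moment survives, so there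
  is convergence in mean square; Cauchy-Schwarz turns this into convergence in mean, the form in
  which the error enters \<open>char_bound\<close>.\<close>

lemma square_law_of_large_numbers:
  "(\<lambda>n. avg (b ^ n) (\<lambda>j. \<bar>(\<Sum>k<n. (X (Suc k) j)\<^sup>2) / real n - v\<bar>)) \<longlonglongrightarrow> 0"
proof -
  let ?B = "M\<^sup>2 + \<bar>v\<bar>"
  let ?Q = "\<lambda>n. avg (b ^ n) (\<lambda>j. (\<Sum>k<n. Z (Suc k) j)\<^sup>2) / (real n)\<^sup>2"
  have "?Q \<longlonglongrightarrow> 0"
  proof (rule tendstoI)
    fix e :: real assume e: "e > 0"
    \<comment> \<open>The summand 1 keeps the denominator of \<epsilon> positive when M and v are
      both 0.\<close>
    define K where "K = ?B + 1"
    define \<epsilon> where "\<epsilon> = e / (2 * K)"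
    have K: "K > 0" unfolding K_def by (simp add: add_nonneg_pos)
    then have \<epsilon>: "\<epsilon> > 0" using e by (simp add: \<epsilon>_def)
    have "(?B + 1) * \<epsilon> = e / 2" unfolding K_def[symmetric] \<epsilon>_def using K by simp
    then have \<epsilon>2: "?B * \<epsilon> < e" using \<epsilon> e unfolding distrib_right by linarith
    obtain R where R: "\<forall>k. \<forall>r\<ge>R. \<forall>a<b ^ k. \<bar>avg (b ^ r) (\<lambda>q. (X (k + r) (a + b ^ k * q))\<^sup>2) - v\<bar> \<le> \<epsilon>"
      using X_square[OF \<epsilon>] by blast
    have "(\<lambda>n. ?B * \<epsilon> + 2 * real R * ?B\<^sup>2 / real n) \<longlonglongrightarrow> ?B * \<epsilon> + 0"
      by (intro tendsto_intros lim_const_over_n)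
    then have "\<forall>\<^sub>F n in sequentially. ?B * \<epsilon> + 2 * real R * ?B\<^sup>2 / real n < e"
      using \<epsilon>2 by (intro order_tendstoD(2)) auto
    with eventually_gt_at_top[of 0] show "\<forall>\<^sub>F n in sequentially. dist (?Q n) 0 < e"
    proof eventually_elim
      case (elim n)
      have "?Q n \<le> (?B * \<epsilon> * (real n)\<^sup>2 + 2 * real R * ?B\<^sup>2 * real n) / (real n)\<^sup>2"
        using sum_Z_second_moment[OF R, of n] \<epsilon> by (intro divide_right_mono) auto
      also have "\<dots> = ?B * \<epsilon> + 2 * real R * ?B\<^sup>2 / real n"
        using elim by (simp add: field_simps power2_eq_square)
      finally have "?Q n < e" using elim by linarith
      moreover have "?Q n \<ge> 0" by (intro divide_nonneg_nonneg avg_nonneg) auto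
      ultimately show ?case by (simp only: dist_real_def diff_zero abs_of_nonneg)
    qed
  qed
  then have lim: "(\<lambda>n. sqrt (?Q n)) \<longlonglongrightarrow> 0"
    using tendsto_real_sqrt by fastforce
  show ?thesis
  proof (rule tendsto_sandwich[OF _ _ tendsto_const lim])
    show "\<forall>\<^sub>F n in sequentially. 0 \<le> avg (b ^ n) (\<lambda>j. \<bar>(\<Sum>k<n. (X (Suc k) j)\<^sup>2) / real n - v\<bar>)"
      by (intro always_eventually allI avg_nonneg) auto
    show "\<forall>\<^sub>F n in sequentially. avg (b ^ n) (\<lambda>j. \<bar>(\<Sum>k<n. (X (Suc k) j)\<^sup>2) / real n - v\<bar>) \<le> sqrt (?Q n)"
      using eventually_gt_at_top[of 0]
    proof eventually_elim
      case (elim n)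
      let ?A = "avg (b ^ n) (\<lambda>j. \<bar>(\<Sum>k<n. (X (Suc k) j)\<^sup>2) / real n - v\<bar>)"
      have "?A\<^sup>2 \<le> avg (b ^ n) (\<lambda>j. \<bar>(\<Sum>k<n. (X (Suc k) j)\<^sup>2) / real n - v\<bar>\<^sup>2)"
        using b_pos by (intro avg_power2_le) auto
      also have "\<dots> = avg (b ^ n) (\<lambda>j. inverse ((real n)\<^sup>2) * (\<Sum>k<n. Z (Suc k) j)\<^sup>2)"
        using elim by (intro avg_cong) (simp add: Z_def sum_subtractf power2_eq_square field_simps)
      also have "\<dots> = ?Q n" unfolding avg_cmult by (simp add: divide_inverse mult.commute)
      finally show ?case by (rule real_le_rsqrt)
    qed
  qed
qed

end

section \<open>Central limit theorem\<close>

text \<open>The growth of 1 + i y is exactly what the factor exp (- y^2 / 2) can absorb. It also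
  bounds the whole product of such factors by an exponential of the sum of the y^2.\<close>

lemma norm_one_plus_ii_le: "cmod (1 + \<i> * complex_of_real y) \<le> exp (y\<^sup>2 / 2)"
proof -
  have "(cmod (1 + \<i> * complex_of_real y))\<^sup>2 = 1 + y\<^sup>2"
    by (simp add: cmod_power2)
  also have "\<dots> \<le> exp (y\<^sup>2)" by (rule exp_ge_add_one_self)
  also have "\<dots> = (exp (y\<^sup>2 / 2))\<^sup>2" by (simp add: exp_double[symmetric])
  finally show ?thesis by (rule power2_le_imp_le) simp
qed

text \<open>Both sides have the Taylor polynomial 1 + i y - y^2 / 2, so the difference is cubic. The
  three error terms contribute 1/6, 1/2 and 1/2, which the constant 2 covers.\<close>

lemma iexp_martingale_factor:
  assumes "\<bar>y\<bar> \<le> 1"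
  shows "cmod (iexp y - (1 + \<i> * complex_of_real y) * complex_of_real (exp (- y\<^sup>2 / 2))) \<le> 2 * \<bar>y\<bar> ^ 3"
proof -
  let ?r = "exp (- y\<^sup>2 / 2) - (1 - y\<^sup>2 / 2)"
  have y4: "y ^ 4 \<le> \<bar>y\<bar> ^ 3"
  proof -
    have "\<bar>y\<bar> ^ 4 \<le> \<bar>y\<bar> ^ 3" using assms by (intro power_decreasing) auto
    then show ?thesis by simp
  qed
  have r: "\<bar>?r\<bar> \<le> y ^ 4 / 4"
  proof -
    define u where "u = y\<^sup>2 / 2"
    have u: "u \<ge> 0" by (simp add: u_def)
    have "exp (- u) \<le> 1 / (1 + u)"
      using exp_ge_add_one_self[of u] u by (simp add: exp_minus field_simps)
    also have "\<dots> = 1 - u + u\<^sup>2 / (1 + u)" using u by (simp add: field_simps power2_eq_square)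
    also have "u\<^sup>2 / (1 + u) \<le> u\<^sup>2"
      using u divide_left_mono[of 1 "1 + u" "u\<^sup>2"] by simp
    finally have "exp (- u) - (1 - u) \<le> u\<^sup>2" by simp
    moreover have "exp (- u) - (1 - u) \<ge> 0" using exp_ge_add_one_self[of "- u"] by simp
    ultimately have "\<bar>exp (- u) - (1 - u)\<bar> \<le> u\<^sup>2" by simp
    then show ?thesis by (simp add: u_def power_divide)
  qed
  have s: "cmod (iexp y - (1 + \<i> * y - y\<^sup>2 / 2)) \<le> \<bar>y\<bar> ^ 3 / 6"
    using iexp_approx1[of y 2]
    by (simp add: numeral_2_eq_2 numeral_3_eq_3 fact_numeral power2_eq_square algebra_simps)
  \<comment> \<open>The middle term arises from (1 + i y) (1 - y^2 / 2) = 1 + i y - y^2 / 2 - i y^3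
    / 2.\<close>
  have eq: "iexp y - (1 + \<i> * complex_of_real y) * complex_of_real (exp (- y\<^sup>2 / 2)) =
     (iexp y - (1 + \<i> * y - y\<^sup>2 / 2)) + \<i> * y ^ 3 / 2 - (1 + \<i> * y) * complex_of_real ?r"
    by (simp add: field_simps power3_eq_cube power2_eq_square)
  have "cmod (\<i> * complex_of_real (y ^ 3) / 2) = \<bar>y\<bar> ^ 3 / 2"
    by (simp add: norm_mult norm_divide norm_power)
  moreover have "cmod ((1 + \<i> * y) * complex_of_real ?r) \<le> 2 * (y ^ 4 / 4)"
  proof -
    have "cmod (1 + \<i> * y) \<le> 2"
      using norm_triangle_ineq[of 1 "\<i> * y"] assms by (simp add: norm_mult)
    then show ?thesis unfolding norm_mult norm_of_real using r by (intro mult_mono) auto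
  qed
  ultimately show ?thesis
    unfolding eq using s y4
      norm_triangle_ineq4[of "(iexp y - (1 + \<i> * y - y\<^sup>2 / 2)) + \<i> * y ^ 3 / 2" "(1 + \<i> * y) * complex_of_real ?r"]
      norm_triangle_ineq[of "iexp y - (1 + \<i> * y - y\<^sup>2 / 2)" "\<i> * y ^ 3 / 2"]
      zero_le_power_abs[of y 3]
    by linarith
qed


context adic_martingale begin

text \<open>Levels start at 1: in the application the slope of level 0 would be an increment of
  \<phi> over a full period, which is 0.\<close>

definition S :: "nat \<Rightarrow> nat \<Rightarrow> real" where "S n j = (\<Sum>k<n. X (Suc k) j)"

text \<open>Averaging first over the highest digit q leaves all factors but the last unchanged, and
  the last one averages to 1 because its X has conditional mean 0. There is no error term, which is
  the strength of the product method.\<close>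

lemma avg_martingale_product:
  fixes c :: complex
  shows "avg (b ^ n) (\<lambda>j. \<Prod>k<n. 1 + c * complex_of_real (X (Suc k) j)) = 1"
proof (induction n)
  case 0
  show ?case by (simp add: avg_def)
next
  case (Suc n)
  have "avg (b ^ Suc n) (\<lambda>j. \<Prod>k<Suc n. 1 + c * complex_of_real (X (Suc k) j)) =
    avg (b ^ n) (\<lambda>a. avg b (\<lambda>q. \<Prod>k<Suc n. 1 + c * complex_of_real (X (Suc k) (a + b ^ n * q))))"
    unfolding power_Suc2 by (rule avg_mult)
  also have "\<dots> = avg (b ^ n) (\<lambda>a. \<Prod>k<n. 1 + c * complex_of_real (X (Suc k) a))"
  proof (rule avg_cong)
    fix a assume a: "a < b ^ n"
    have "avg b (\<lambda>q. \<Prod>k<Suc n. 1 + c * complex_of_real (X (Suc k) (a + b ^ n * q))) =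
      avg b (\<lambda>q. (\<Prod>k<n. 1 + c * complex_of_real (X (Suc k) a)) *
        (1 + c * complex_of_real (X (Suc n) (a + b ^ n * q))))"
      by (simp add: X_periodic_le)
    also have "\<dots> = (\<Prod>k<n. 1 + c * complex_of_real (X (Suc k) a)) *
        (avg b (\<lambda>q. 1) + c * avg b (\<lambda>q. complex_of_real (X (Suc n) (a + b ^ n * q))))"
      by (simp add: avg_cmult avg_add)
    also have "avg b (\<lambda>q. complex_of_real (X (Suc n) (a + b ^ n * q))) = 0"
      by (simp add: avg_def of_real_sum[symmetric] X_martingale[OF a] del: of_real_sum)
    finally show "avg b (\<lambda>q. \<Prod>k<Suc n. 1 + c * complex_of_real (X (Suc k) (a + b ^ n * q))) =
      (\<Prod>k<n. 1 + c * complex_of_real (X (Suc k) a))"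
      using b_pos by simp
  qed
  finally show ?case using Suc.IH by simp
qed

text \<open>Two replacements: \<open>A\<close> exchanges the exponential for T times exp (- s^2 V /
  2), and \<open>B\<close> exchanges the random V for v at a cost governed by the law of large
  numbers. Afterwards the second factor is constant and T has mean 1. The hypothesis on s makes
  every y at most 1 in absolute value, as the Taylor estimate requires.\<close>

lemma char_bound:
  assumes "n > 0" and s: "\<bar>s\<bar> * M \<le> sqrt n" and v: "v \<ge> 0"
  shows "cmod (avg (b ^ n) (\<lambda>j. iexp (s * (S n j / sqrt n))) - complex_of_real (exp (- (s\<^sup>2 * v) / 2))) \<le>
    2 * (\<bar>s\<bar> * M) ^ 3 / sqrt n +
    exp (s\<^sup>2 * M\<^sup>2 / 2) * (s\<^sup>2 / 2) * avg (b ^ n) (\<lambda>j. \<bar>(\<Sum>k<n. (X (Suc k) j)\<^sup>2) / real n - v\<bar>)"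
proof -
  define y where "y k j = s * X (Suc k) j / sqrt n" for k j
  define T where "T j = (\<Prod>k<n. 1 + \<i> * complex_of_real (y k j))" for j
  define V where "V j = (\<Sum>k<n. (X (Suc k) j)\<^sup>2) / real n" for j
  have y: "\<bar>y k j\<bar> \<le> \<bar>s\<bar> * M / sqrt n" for k j
    unfolding y_def by (simp add: abs_mult divide_right_mono mult_left_mono X_bound)
  have y1: "\<bar>y k j\<bar> \<le> 1" for k j
  proof -
    have "\<bar>s\<bar> * M / sqrt n \<le> 1" using s assms(1) by (subst divide_le_eq_1_pos) auto
    then show ?thesis using y[of k j] by linarith
  qed
  have sumy: "(\<Sum>k<n. (y k j)\<^sup>2) = s\<^sup>2 * V j" for j
    by (simp add: y_def V_def power_mult_distrib power_divide sum_distrib_left sum_divide_distrib[symmetric])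
  have V: "0 \<le> V j" "V j \<le> M\<^sup>2" for j
  proof -
    show "0 \<le> V j" unfolding V_def by (intro divide_nonneg_nonneg sum_nonneg) auto
    have "(\<Sum>k<n. (X (Suc k) j)\<^sup>2) \<le> (\<Sum>k<n. M\<^sup>2)" by (intro sum_mono X_square_le)
    then show "V j \<le> M\<^sup>2" using assms(1) by (simp add: V_def field_simps)
  qed
  have T: "cmod (T j) \<le> exp (s\<^sup>2 * M\<^sup>2 / 2)" for j
  proof -
    have "cmod (T j) \<le> (\<Prod>k<n. exp ((y k j)\<^sup>2 / 2))"
      unfolding T_def prod_norm[symmetric] by (intro prod_mono) (simp add: norm_one_plus_ii_le)
    also have "\<dots> = exp (s\<^sup>2 * V j / 2)"
      by (simp only: exp_sum[OF finite_lessThan, symmetric] sum_divide_distrib[symmetric] sumy)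
    also have "\<dots> \<le> exp (s\<^sup>2 * M\<^sup>2 / 2)" using V[of j] by (simp add: mult_left_mono)
    finally show ?thesis .
  qed
  have A: "cmod (iexp (s * (S n j / sqrt n)) - T j * complex_of_real (exp (- (s\<^sup>2 * V j) / 2))) \<le> 2 * (\<bar>s\<bar> * M) ^ 3 / sqrt n" for j
  proof -
    let ?w = "\<lambda>k. (1 + \<i> * complex_of_real (y k j)) * complex_of_real (exp (- (y k j)\<^sup>2 / 2))"
    have "s * (S n j / sqrt n) = (\<Sum>k<n. y k j)"
      by (simp add: S_def y_def sum_distrib_left sum_divide_distrib)
    then have "iexp (s * (S n j / sqrt n)) = (\<Prod>k<n. iexp (y k j))"
      by (simp only: exp_sum[OF finite_lessThan, symmetric] of_real_sum sum_distrib_left)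
    moreover have "T j * complex_of_real (exp (- (s\<^sup>2 * V j) / 2)) = (\<Prod>k<n. ?w k)"
    proof -
      have "- (s\<^sup>2 * V j) / 2 = (\<Sum>k<n. - (y k j)\<^sup>2 / 2)"
        by (simp only: sumy[symmetric] sum_divide_distrib[symmetric] sum_negf)
      then have "exp (- (s\<^sup>2 * V j) / 2) = (\<Prod>k<n. exp (- (y k j)\<^sup>2 / 2))"
        by (simp only: exp_sum[OF finite_lessThan])
      then show ?thesis by (simp only: T_def prod.distrib of_real_prod)
    qed
    \<comment> \<open>Since all factors of both products lie in the closed unit disc, the products
      differ by at most the sum of the differences of the factors.\<close>
    moreover have "cmod ((\<Prod>k<n. iexp (y k j)) - (\<Prod>k<n. ?w k)) \<le> (\<Sum>k<n. cmod (iexp (y k j) - ?w k))"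
    proof (rule norm_prod_diff)
      fix k
      have "cmod (?w k) \<le> exp ((y k j)\<^sup>2 / 2) * exp (- (y k j)\<^sup>2 / 2)"
        unfolding norm_mult by (intro mult_mono norm_one_plus_ii_le) auto
      then show "cmod (?w k) \<le> 1" by (simp add: exp_add[symmetric])
    qed auto
    moreover have "(\<Sum>k<n. cmod (iexp (y k j) - ?w k)) \<le> (\<Sum>k<n. 2 * (\<bar>s\<bar> * M / sqrt n) ^ 3)"
    proof (rule sum_mono)
      fix k
      have "cmod (iexp (y k j) - ?w k) \<le> 2 * \<bar>y k j\<bar> ^ 3" by (rule iexp_martingale_factor[OF y1])
      also have "\<dots> \<le> 2 * (\<bar>s\<bar> * M / sqrt n) ^ 3" by (intro mult_left_mono power_mono y) auto
      finally show "cmod (iexp (y k j) - ?w k) \<le> 2 * (\<bar>s\<bar> * M / sqrt n) ^ 3" .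
    qed
    \<comment> \<open>There are n cubic errors, each with (sqrt n)^3 = n sqrt n in the
      denominator.\<close>
    moreover have "(\<Sum>k<n. 2 * (\<bar>s\<bar> * M / sqrt n) ^ 3) = 2 * (\<bar>s\<bar> * M) ^ 3 / sqrt n"
    proof -
      have "sqrt (real n) ^ 3 = real n * sqrt (real n)" by (simp add: power3_eq_cube)
      then show ?thesis using assms(1) by (simp add: power_divide)
    qed
    ultimately show ?thesis by simp
  qed
  have B: "cmod (T j * complex_of_real (exp (- (s\<^sup>2 * V j) / 2)) - T j * complex_of_real (exp (- (s\<^sup>2 * v) / 2))) \<le>
      exp (s\<^sup>2 * M\<^sup>2 / 2) * (s\<^sup>2 / 2) * \<bar>V j - v\<bar>" for j
  proof -
    have E: "\<bar>exp (- p) - exp (- q)\<bar> \<le> \<bar>p - q\<bar>" if "0 \<le> p" "0 \<le> q" for p q :: real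
    proof -
      have *: "\<bar>exp (- p) - exp (- q)\<bar> \<le> \<bar>p - q\<bar>" if "0 \<le> p" "p \<le> q" for p q :: real
      proof -
        have "exp (- p) - exp (- q) = exp (- p) * (1 - exp (- (q - p)))"
          by (simp add: algebra_simps exp_add[symmetric])
        also have "\<dots> \<le> 1 * (q - p)"
        proof (intro mult_mono)
          show "1 - exp (- (q - p)) \<le> q - p" using exp_ge_add_one_self[of "- (q - p)"] by linarith
        qed (use that in auto)
        finally show ?thesis using that by simp
      qed
      show ?thesis using *[of p q] *[of q p] that by (cases "p \<le> q") auto
    qed
    have "\<bar>exp (- (s\<^sup>2 * V j / 2)) - exp (- (s\<^sup>2 * v / 2))\<bar> \<le> \<bar>s\<^sup>2 * V j / 2 - s\<^sup>2 * v / 2\<bar>"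
      using V[of j] v by (intro E) auto
    also have "\<dots> = (s\<^sup>2 / 2) * \<bar>V j - v\<bar>"
      by (simp add: abs_mult right_diff_distrib[symmetric] diff_divide_distrib[symmetric])
    finally have "\<bar>exp (- (s\<^sup>2 * V j) / 2) - exp (- (s\<^sup>2 * v) / 2)\<bar> \<le> (s\<^sup>2 / 2) * \<bar>V j - v\<bar>" by simp
    then show ?thesis
      unfolding right_diff_distrib[symmetric] norm_mult of_real_diff[symmetric] norm_of_real mult.assoc
      by (intro mult_mono T) auto
  qed
  have C: "avg (b ^ n) (\<lambda>j. T j * complex_of_real (exp (- (s\<^sup>2 * v) / 2))) = complex_of_real (exp (- (s\<^sup>2 * v) / 2))"
  proof -
    have "avg (b ^ n) T = 1"
      using avg_martingale_product[of n "\<i> * complex_of_real (s / sqrt n)"]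
      by (simp add: T_def[abs_def] y_def mult.assoc)
    then show ?thesis using avg_cmult[of "b ^ n" "complex_of_real (exp (- (s\<^sup>2 * v) / 2))" T]
      by (simp add: mult.commute)
  qed
  have "cmod (avg (b ^ n) (\<lambda>j. iexp (s * (S n j / sqrt n))) - complex_of_real (exp (- (s\<^sup>2 * v) / 2))) =
    cmod (avg (b ^ n) (\<lambda>j. iexp (s * (S n j / sqrt n)) - T j * complex_of_real (exp (- (s\<^sup>2 * v) / 2))))"
    by (subst C[symmetric]) (simp only: avg_diff)
  also have "\<dots> \<le> avg (b ^ n) (\<lambda>j. cmod (iexp (s * (S n j / sqrt n)) - T j * complex_of_real (exp (- (s\<^sup>2 * v) / 2))))"
    by (rule norm_avg_le)
  also have "\<dots> \<le> avg (b ^ n) (\<lambda>j. 2 * (\<bar>s\<bar> * M) ^ 3 / sqrt n + exp (s\<^sup>2 * M\<^sup>2 / 2) * (s\<^sup>2 / 2) * \<bar>V j - v\<bar>)"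
    by (intro avg_mono norm_diff_triangle_le[OF A B])
  also have "\<dots> = 2 * (\<bar>s\<bar> * M) ^ 3 / sqrt n + exp (s\<^sup>2 * M\<^sup>2 / 2) * (s\<^sup>2 / 2) * avg (b ^ n) (\<lambda>j. \<bar>V j - v\<bar>)"
    using avg_const[of "b ^ n" "2 * (\<bar>s\<bar> * M) ^ 3 / sqrt n"] b_pos by (simp only: avg_add avg_cmult) simp
  finally show ?thesis by (simp add: V_def)
qed

text \<open>With k = 0 and a = 0, \<open>X_square\<close> approximates v arbitrarily well by
  averages of squares.\<close>

lemma v_nonneg: "v \<ge> 0"
proof (rule field_le_epsilon)
  fix e :: real assume "e > 0"
  from X_square[OF this] obtain R where
    "\<forall>k. \<forall>r\<ge>R. \<forall>a<b ^ k. \<bar>avg (b ^ r) (\<lambda>q. (X (k + r) (a + b ^ k * q))\<^sup>2) - v\<bar> \<le> e" by blast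
  then have "\<bar>avg (b ^ R) (\<lambda>q. (X (0 + R) (0 + b ^ 0 * q))\<^sup>2) - v\<bar> \<le> e"
    by (metis le_refl less_numeral_extra(1) power_0)
  moreover have "avg (b ^ R) (\<lambda>q. (X (0 + R) (0 + b ^ 0 * q))\<^sup>2) \<ge> 0" by (rule avg_nonneg) simp
  ultimately show "0 \<le> v + e" by linarith
qed

lemma char_limit:
  "(\<lambda>n. avg (b ^ n) (\<lambda>j. iexp (s * (S n j / sqrt n)))) \<longlonglongrightarrow> complex_of_real (exp (- (s\<^sup>2 * v) / 2))"
proof -
  let ?E = "\<lambda>n. 2 * (\<bar>s\<bar> * M) ^ 3 / sqrt (real n) + exp (s\<^sup>2 * M\<^sup>2 / 2) * (s\<^sup>2 / 2) *
    avg (b ^ n) (\<lambda>j. \<bar>(\<Sum>k<n. (X (Suc k) j)\<^sup>2) / real n - v\<bar>)"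
  have sq: "filterlim (\<lambda>n. sqrt (real n)) at_top sequentially"
    by (rule filterlim_compose[OF sqrt_at_top filterlim_real_sequentially])
  have "?E \<longlonglongrightarrow> 0 + exp (s\<^sup>2 * M\<^sup>2 / 2) * (s\<^sup>2 / 2) * 0"
    by (intro tendsto_add tendsto_mult tendsto_const square_law_of_large_numbers
        tendsto_divide_0[OF tendsto_const filterlim_at_top_imp_at_infinity[OF sq]])
  then have E: "?E \<longlonglongrightarrow> 0" by simp
  have "\<forall>\<^sub>F n in sequentially. \<bar>s\<bar> * M \<le> sqrt (real n)"
    using sq by (simp add: filterlim_at_top)
  with eventually_gt_at_top[of 0]
  have "\<forall>\<^sub>F n in sequentially. cmod (avg (b ^ n) (\<lambda>j. iexp (s * (S n j / sqrt n))) - complex_of_real (exp (- (s\<^sup>2 * v) / 2))) \<le> ?E n"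
    by eventually_elim (rule char_bound; simp add: v_nonneg)
  from Lim_null_comparison[OF this E] show ?thesis by (simp add: LIM_zero_iff)
qed

end

text \<open>Truncation at K turns the absolute value into a bounded continuous test function; the
  part cut off is controlled by second moments, uniformly in n.\<close>

lemma min_abs_bounds:
  fixes x K :: real
  assumes "K > 0"
  shows "min \<bar>x\<bar> K \<le> \<bar>x\<bar>" and "\<bar>x\<bar> \<le> min \<bar>x\<bar> K + x\<^sup>2 / K"
proof -
  show "\<bar>x\<bar> \<le> min \<bar>x\<bar> K + x\<^sup>2 / K"
  proof (cases "\<bar>x\<bar> \<le> K")
    case True then show ?thesis using assms by simp
  next
    case False
    then have "\<bar>x\<bar> * K \<le> x\<^sup>2" using mult_left_mono[of K "\<bar>x\<bar>" "\<bar>x\<bar>"] by (simp add: power2_eq_square abs_mult[symmetric])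
    then show ?thesis using assms False by (simp add: field_simps add_increasing)
  qed
qed simp

lemma avg_eq_integral:
  fixes f :: "real \<Rightarrow> 'a::{real_normed_field, banach, second_countable_topology}"
  assumes "N > 0" and [measurable]: "f \<in> borel_measurable borel"
  shows "integral\<^sup>L (distr (measure_pmf (pmf_of_set {..<N})) borel g) f = avg N (\<lambda>j. f (g j))"
proof -
  have ne: "{..<N} \<noteq> {}" using assms(1) by (simp add: lessThan_empty_iff)
  have "integral\<^sup>L (distr (measure_pmf (pmf_of_set {..<N})) borel g) f =
      (\<integral>j. f (g j) \<partial>measure_pmf (pmf_of_set {..<N}))"
    by (subst integral_distr) (auto simp: measurable_pmf_measure1)
  also have "\<dots> = (\<Sum>j<N. pmf (pmf_of_set {..<N}) j *\<^sub>R f (g j))"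
    using ne by (intro integral_measure_pmf) auto
  also have "\<dots> = (\<Sum>j<N. f (g j) / of_nat N)"
    using ne by (intro sum.cong refl) (auto simp: indicator_def scaleR_conv_of_real divide_inverse mult.commute)
  finally show ?thesis by (simp add: avg_def sum_divide_distrib)
qed

lemma std_normal_integrable_square: "integrable std_normal_distribution (\<lambda>x. x\<^sup>2)"
  and std_normal_square: "(\<integral>x. x\<^sup>2 \<partial>std_normal_distribution) = 1"
  and std_normal_integrable_abs: "integrable std_normal_distribution abs"
  and std_normal_abs: "(\<integral>x. \<bar>x\<bar> \<partial>std_normal_distribution) = sqrt (2 / pi)"
  using std_normal_moment_even[of 1] std_normal_moment_abs_odd[of 0]
  by (auto simp: integrable_density integral_density has_bochner_integral_iff)

section \<open>Weak convergence and convergence of the first absolute moment\<close>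

context adic_martingale begin

lemma S_Suc: "S (Suc n) j = S n j + X (Suc n) j"
  by (simp add: S_def)

lemma S_periodic: "n \<le> l \<Longrightarrow> S n (j + b ^ l * q) = S n j"
  by (simp add: S_def X_periodic_le)

text \<open>Martingale differences are orthogonal: given the n lowest digits the cross term 2 S X
  averages to 0, so each level adds at most M^2.\<close>

lemma S_second_moment: "avg (b ^ n) (\<lambda>j. (S n j)\<^sup>2) \<le> real n * M\<^sup>2"
proof (induction n)
  case 0 show ?case by (simp add: S_def avg_def)
next
  case (Suc n)
  have "avg (b ^ Suc n) (\<lambda>j. (S (Suc n) j)\<^sup>2) =
    avg (b ^ n) (\<lambda>a. avg b (\<lambda>q. (S (Suc n) (a + b ^ n * q))\<^sup>2))"
    unfolding power_Suc2 by (rule avg_mult)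
  also have "\<dots> \<le> avg (b ^ n) (\<lambda>a. (S n a)\<^sup>2 + M\<^sup>2)"
  proof (rule avg_mono)
    fix a assume a: "a < b ^ n"
    have "avg b (\<lambda>q. (S (Suc n) (a + b ^ n * q))\<^sup>2) =
      avg b (\<lambda>q. (S n a)\<^sup>2 + 2 * S n a * X (Suc n) (a + b ^ n * q) + (X (Suc n) (a + b ^ n * q))\<^sup>2)"
      
      by (simp only: S_Suc S_periodic[OF le_refl] power2_sum) (simp add: algebra_simps)
    also have "\<dots> = (S n a)\<^sup>2 + 2 * S n a * avg b (\<lambda>q. X (Suc n) (a + b ^ n * q)) +
       avg b (\<lambda>q. (X (Suc n) (a + b ^ n * q))\<^sup>2)"
      using b_pos by (simp add: avg_add avg_cmult)
    also have "avg b (\<lambda>q. X (Suc n) (a + b ^ n * q)) = 0"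
      by (simp add: avg_def X_martingale[OF a])
    also have "avg b (\<lambda>q. (X (Suc n) (a + b ^ n * q))\<^sup>2) \<le> M\<^sup>2"
      using b_pos norm_avg_bound[of b "\<lambda>q. (X (Suc n) (a + b ^ n * q))\<^sup>2" "M\<^sup>2"] X_square_le by simp
    finally show "avg b (\<lambda>q. (S (Suc n) (a + b ^ n * q))\<^sup>2) \<le> (S n a)\<^sup>2 + M\<^sup>2" by simp
  qed
  also have "\<dots> = avg (b ^ n) (\<lambda>a. (S n a)\<^sup>2) + M\<^sup>2" using b_pos by (simp add: avg_add)
  finally show ?case using Suc.IH by (simp add: algebra_simps)
qed

text \<open>The limit is written as an image of the standard normal law, so that the degenerate case
  v = 0, a point mass at 0, is included.\<close>

lemma weak_limit:
  "weak_conv_m (\<lambda>n. distr (measure_pmf (pmf_of_set {..<b ^ n})) borel (\<lambda>j. S n j / sqrt n))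
     (distr std_normal_distribution borel (\<lambda>x. sqrt v * x))"
proof (rule levy_continuity)
  interpret N: prob_space std_normal_distribution by (rule prob_space_normal_density) simp
  show "real_distribution (distr (measure_pmf (pmf_of_set {..<b ^ n})) borel (\<lambda>j. S n j / sqrt n))" for n
    by (rule prob_space.real_distribution_distr[OF measure_pmf.prob_space_axioms]) simp
  show "real_distribution (distr std_normal_distribution borel (\<lambda>x. sqrt v * x))"
    by (rule N.real_distribution_distr) simp
  fix s
  have "char (distr std_normal_distribution borel (\<lambda>x. sqrt v * x)) s = char std_normal_distribution (s * sqrt v)"
    unfolding char_def by (subst integral_distr) (simp_all add: mult.assoc)
  also have "\<dots> = complex_of_real (exp (- (s\<^sup>2 * v) / 2))"
    using v_nonneg by (simp add: char_std_normal_distribution power_mult_distrib)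
  finally have "char (distr std_normal_distribution borel (\<lambda>x. sqrt v * x)) s = complex_of_real (exp (- (s\<^sup>2 * v) / 2))" .
  moreover have "char (distr (measure_pmf (pmf_of_set {..<b ^ n})) borel (\<lambda>j. S n j / sqrt n)) s =
      avg (b ^ n) (\<lambda>j. iexp (s * (S n j / sqrt n)))" for n
    unfolding char_def using b_pos by (subst avg_eq_integral) auto
  ultimately show "(\<lambda>n. char (distr (measure_pmf (pmf_of_set {..<b ^ n})) borel (\<lambda>j. S n j / sqrt n)) s) \<longlonglongrightarrow>
      char (distr std_normal_distribution borel (\<lambda>x. sqrt v * x)) s"
    using char_limit[of s] by simp
qed

lemma truncated_limit:
  assumes "K > 0"
  shows "(\<lambda>n. avg (b ^ n) (\<lambda>j. min \<bar>S n j / sqrt n\<bar> K)) \<longlonglongrightarrow>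
    (\<integral>x. min \<bar>sqrt v * x\<bar> K \<partial>std_normal_distribution)"
proof -
  interpret N: prob_space std_normal_distribution by (rule prob_space_normal_density) simp
  have "(\<lambda>n. integral\<^sup>L (distr (measure_pmf (pmf_of_set {..<b ^ n})) borel (\<lambda>j. S n j / sqrt n)) (\<lambda>x. min \<bar>x\<bar> K)) \<longlonglongrightarrow>
    integral\<^sup>L (distr std_normal_distribution borel (\<lambda>x. sqrt v * x)) (\<lambda>x. min \<bar>x\<bar> K)"
  proof (rule weak_conv_imp_integral_bdd_continuous_conv[OF _ _ weak_limit])
    show "real_distribution (distr (measure_pmf (pmf_of_set {..<b ^ n})) borel (\<lambda>j. S n j / sqrt n))" for n
      by (rule prob_space.real_distribution_distr[OF measure_pmf.prob_space_axioms]) simp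
    show "real_distribution (distr std_normal_distribution borel (\<lambda>x. sqrt v * x))"
      by (rule N.real_distribution_distr) simp
    show "norm (min \<bar>x\<bar> K) \<le> K" for x using assms by auto
    show "isCont (\<lambda>x. min \<bar>x\<bar> K) x" for x by (intro continuous_intros)
  qed
  moreover have "integral\<^sup>L (distr (measure_pmf (pmf_of_set {..<b ^ n})) borel (\<lambda>j. S n j / sqrt n)) (\<lambda>x. min \<bar>x\<bar> K) =
      avg (b ^ n) (\<lambda>j. min \<bar>S n j / sqrt n\<bar> K)" for n
    using b_pos by (subst avg_eq_integral) auto
  moreover have "integral\<^sup>L (distr std_normal_distribution borel (\<lambda>x. sqrt v * x)) (\<lambda>x. min \<bar>x\<bar> K) =
      (\<integral>x. min \<bar>sqrt v * x\<bar> K \<partial>std_normal_distribution)"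
    by (subst integral_distr) auto
  ultimately show ?thesis by simp
qed

text \<open>Truncate both S / sqrt n and the Gaussian at a common level K: the truncated means
  converge by weak convergence, and the two truncation errors are at most M^2 / K and v / K. The
  value of the limit is sqrt v times the first absolute moment sqrt (2 / pi) of the standard normal
  law.\<close>

lemma mean_abs_limit: "(\<lambda>n. avg (b ^ n) (\<lambda>j. \<bar>S n j\<bar> / sqrt n)) \<longlonglongrightarrow> sqrt (2 * v / pi)"
proof (rule tendstoI)
  fix e :: real assume e: "e > 0"
  \<comment> \<open>K is chosen to make M^2 / K + v / K + 1 / K equal to e / 2; the 1 keeps C
    positive when M and v vanish.\<close>
  define C where "C = M\<^sup>2 + v + 1"
  define K where "K = 2 * C / e"
  have C: "C > 0" using v_nonneg by (simp add: C_def add_nonneg_pos)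
  have K: "K > 0" using e C by (simp add: K_def)
  have eK: "(M\<^sup>2 + v + 1) / K = e / 2" unfolding C_def[symmetric] using e C by (simp add: K_def)
  let ?N = "\<integral>x. min \<bar>sqrt v * x\<bar> K \<partial>std_normal_distribution"
  interpret N: prob_space std_normal_distribution by (rule prob_space_normal_density) simp
  have int: "integrable std_normal_distribution (\<lambda>x. min \<bar>sqrt v * x\<bar> K)"
    using K by (intro N.integrable_const_bound[of _ K]) auto
  have absint: "(\<integral>x. \<bar>sqrt v * x\<bar> \<partial>std_normal_distribution) = sqrt (2 * v / pi)"
    using v_nonneg by (simp add: abs_mult std_normal_abs real_sqrt_mult real_sqrt_divide)
  have absinteg: "integrable std_normal_distribution (\<lambda>x. \<bar>sqrt v * x\<bar>)"
    by (simp add: abs_mult std_normal_integrable_abs)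
  have N1: "?N \<le> sqrt (2 * v / pi)"
    unfolding absint[symmetric] by (intro integral_mono int absinteg min_abs_bounds K)
  have N2: "sqrt (2 * v / pi) \<le> ?N + v / K"
  proof -
    have "sqrt (2 * v / pi) \<le> (\<integral>x. min \<bar>sqrt v * x\<bar> K + (sqrt v * x)\<^sup>2 / K \<partial>std_normal_distribution)"
      unfolding absint[symmetric]
      by (intro integral_mono Bochner_Integration.integrable_add int absinteg min_abs_bounds K)
        (simp add: power_mult_distrib std_normal_integrable_square)
    also have "\<dots> = ?N + v / K"
      using v_nonneg int
      by (subst Bochner_Integration.integral_add) (auto simp: power_mult_distrib std_normal_integrable_square std_normal_square)
    finally show ?thesis .
  qed
  let ?A = "\<lambda>n. avg (b ^ n) (\<lambda>j. \<bar>S n j\<bar> / sqrt n)"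
  let ?T = "\<lambda>n. avg (b ^ n) (\<lambda>j. min \<bar>S n j / sqrt n\<bar> K)"
  have "\<forall>\<^sub>F n in sequentially. dist (?T n) ?N < e / 2"
    using truncated_limit[OF K] e by (intro tendstoD) auto
  with eventually_gt_at_top[of 0] show "\<forall>\<^sub>F n in sequentially. dist (?A n) (sqrt (2 * v / pi)) < e"
  proof eventually_elim
    case (elim n)
    have "?T n \<le> ?A n" using min_abs_bounds(1)[OF K] by (intro avg_mono) (metis abs_divide abs_of_nonneg real_sqrt_ge_zero of_nat_0_le_iff)
    moreover have "?A n \<le> ?T n + M\<^sup>2 / K"
    proof -
      have "?A n \<le> avg (b ^ n) (\<lambda>j. min \<bar>S n j / sqrt n\<bar> K + inverse (real n * K) * (S n j)\<^sup>2)"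
      proof (rule avg_mono)
        fix j
        have "\<bar>S n j\<bar> / sqrt n = \<bar>S n j / sqrt n\<bar>" by simp
        also have "\<dots> \<le> min \<bar>S n j / sqrt n\<bar> K + (S n j / sqrt n)\<^sup>2 / K" by (rule min_abs_bounds(2)[OF K])
        also have "(S n j / sqrt n)\<^sup>2 / K = inverse (real n * K) * (S n j)\<^sup>2"
          by (simp add: power_divide field_simps)
        finally show "\<bar>S n j\<bar> / sqrt n \<le> min \<bar>S n j / sqrt n\<bar> K + inverse (real n * K) * (S n j)\<^sup>2" .
      qed
      also have "\<dots> = ?T n + inverse (real n * K) * avg (b ^ n) (\<lambda>j. (S n j)\<^sup>2)" by (simp only: avg_add avg_cmult)
      also have "\<dots> \<le> ?T n + inverse (real n * K) * (real n * M\<^sup>2)"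
        using K elim by (intro add_left_mono mult_left_mono S_second_moment) auto
      also have "\<dots> = ?T n + M\<^sup>2 / K" using elim by (simp add: field_simps)
      finally show ?thesis .
    qed
    moreover have "M\<^sup>2 / K + v / K + 1 / K = e / 2" using eK by (simp add: add_divide_distrib)
    moreover have "0 < 1 / K" "0 \<le> v / K" "0 \<le> M\<^sup>2 / K" using K v_nonneg by auto
    ultimately show ?case using elim N1 N2 unfolding dist_real_def by linarith
  qed
qed

end

section \<open>Variation sums\<close>

context adic_martingale begin

lemma S_diff_bound: "\<bar>S (m + p) j - S m j\<bar> \<le> real p * M"
proof (induction p)
  case 0 show ?case by simp
next
  case (Suc p)
  have "S (m + Suc p) j = S (m + p) j + X (Suc (m + p)) j" by (simp add: S_Suc)
  then show ?case using Suc.IH X_bound[of "Suc (m + p)" j] by (simp add: algebra_simps)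
qed

lemma S_bound: "\<bar>S n j\<bar> \<le> real n * M"
  using S_diff_bound[of 0 n j] by (simp add: S_def)

text \<open>With m = n - p, write j = q + b^m * i, where i < a. Dropping the top p levels changes S
  by at most p M, negligible against sqrt n, and the remaining sum depends only on q. As q runs over
  a full period, \<open>mean_abs_limit\<close> applies, once for each i.\<close>

lemma block_sum_limit:
  "(\<lambda>n. (\<Sum>j<a * b ^ (n - p). \<bar>S n j\<bar>) / (real b ^ n * sqrt n)) \<longlonglongrightarrow> real a / real b ^ p * sqrt (2 * v / pi)"
proof (rule LIMSEQ_offset[of _ p])
  let ?W = "\<lambda>m. (\<Sum>j<a * b ^ m. \<bar>S (m + p) j\<bar>) / (real b ^ (m + p) * sqrt (real (m + p)))"
  \<comment> \<open>The comparison quantity sees only the first m levels; the square root converts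
    its normalisation from sqrt m to sqrt (m + p).\<close>
  let ?V = "\<lambda>m. real a / real b ^ p * (avg (b ^ m) (\<lambda>j. \<bar>S m j\<bar> / sqrt m) * sqrt (real m / real (m + p)))"
  have sq: "filterlim (\<lambda>m. sqrt (real (m + p))) at_top sequentially"
    by (intro filterlim_compose[OF sqrt_at_top] filterlim_compose[OF filterlim_real_sequentially] filterlim_add_const_nat_at_top)
  have "(\<lambda>m. real m / real (m + p)) \<longlonglongrightarrow> 1"
  proof -
    have "(\<lambda>m. 1 - real p * inverse (real (m + p))) \<longlonglongrightarrow> 1 - real p * 0"
      by (intro tendsto_intros LIMSEQ_ignore_initial_segment[OF lim_inverse_n])
    then have "(\<lambda>m. 1 - real p * inverse (real (m + p))) \<longlonglongrightarrow> 1" by simp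
    moreover have "\<forall>\<^sub>F m in sequentially. 1 - real p * inverse (real (m + p)) = real m / real (m + p)"
      using eventually_gt_at_top[of 0] by eventually_elim (simp add: field_simps)
    ultimately show ?thesis by (rule Lim_transform_eventually)
  qed
  then have "(\<lambda>m. sqrt (real m / real (m + p))) \<longlonglongrightarrow> 1" using tendsto_real_sqrt by fastforce
  then have "?V \<longlonglongrightarrow> real a / real b ^ p * (sqrt (2 * v / pi) * 1)"
    by (intro tendsto_mult tendsto_const mean_abs_limit)
  then have V: "?V \<longlonglongrightarrow> real a / real b ^ p * sqrt (2 * v / pi)" by simp
  have err: "(\<lambda>m. real a / real b ^ p * (real p * M) / sqrt (real (m + p))) \<longlonglongrightarrow> 0"
    by (rule tendsto_divide_0[OF tendsto_const filterlim_at_top_imp_at_infinity[OF sq]])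
  have "\<forall>\<^sub>F m in sequentially. norm (?W m - ?V m) \<le> real a / real b ^ p * (real p * M) / sqrt (real (m + p))"
    using eventually_gt_at_top[of 0]
  proof eventually_elim
    case (elim m)
    have split: "(\<Sum>j<a * b ^ m. \<bar>S (m + p) j\<bar>) = (\<Sum>q<b ^ m. \<Sum>i<a. \<bar>S (m + p) (q + b ^ m * i)\<bar>)"
      using sum_lessThan_mult[of _ "b ^ m" a] by (simp add: mult.commute)
    have V_eq: "?V m = (\<Sum>q<b ^ m. \<Sum>i<a. \<bar>S m q\<bar>) / (real b ^ (m + p) * sqrt (real (m + p)))"
      using elim b_pos
      by (simp add: avg_def sum_divide_distrib[symmetric] sum_distrib_left[symmetric] real_sqrt_divide power_add field_simps)
    have "\<bar>(\<Sum>j<a * b ^ m. \<bar>S (m + p) j\<bar>) - (\<Sum>q<b ^ m. \<Sum>i<a. \<bar>S m q\<bar>)\<bar> \<le>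
        (\<Sum>q<b ^ m. \<Sum>i<a. real p * M)"
      unfolding split sum_subtractf[symmetric]
    proof (intro order_trans[OF sum_abs] sum_mono)
      fix q i
      have "\<bar>S (m + p) (q + b ^ m * i) - S m (q + b ^ m * i)\<bar> \<le> real p * M" by (rule S_diff_bound)
      then show "\<bar>\<bar>S (m + p) (q + b ^ m * i)\<bar> - \<bar>S m q\<bar>\<bar> \<le> real p * M"
        by (simp add: S_periodic)
    qed
    also have "\<dots> = real b ^ m * (real a * (real p * M))" by simp
    finally have "\<bar>(\<Sum>j<a * b ^ m. \<bar>S (m + p) j\<bar>) - (\<Sum>q<b ^ m. \<Sum>i<a. \<bar>S m q\<bar>)\<bar> /
        (real b ^ (m + p) * sqrt (real (m + p))) \<le>
      real b ^ m * (real a * (real p * M)) / (real b ^ (m + p) * sqrt (real (m + p)))"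
      by (intro divide_right_mono) auto
    also have "\<dots> = real a / real b ^ p * (real p * M) / sqrt (real (m + p))"
      using b_pos by (simp add: power_add)
    finally show ?case unfolding V_eq
      by (simp only: diff_divide_distrib[symmetric] real_norm_def abs_divide) simp
  qed
  from Lim_null_comparison[OF this err] have "(\<lambda>m. ?W m - ?V m) \<longlonglongrightarrow> 0" .
  from tendsto_add[OF this V]
  show "(\<lambda>n. (\<Sum>j<a * b ^ (n + p - p). \<bar>S (n + p) j\<bar>) / (real b ^ (n + p) * sqrt (real (n + p))))
      \<longlonglongrightarrow> real a / real b ^ p * sqrt (2 * v / pi)"
    by simp
qed

text \<open>The number of summands is kept abstract and compared with multiples of b^(n - p). It
  will be the number of cells met up to time t, capped at b^n.\<close>

context
  fixes t :: real and c :: "nat \<Rightarrow> nat"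
  assumes t: "t \<ge> 0" and b2: "b \<ge> 2"
    and c_lower: "\<And>p n. p \<le> n \<Longrightarrow> nat \<lfloor>t * real b ^ p\<rfloor> * b ^ (n - p) \<le> c n"
    and c_upper: "\<And>p n. p \<le> n \<Longrightarrow> c n \<le> (nat \<lfloor>t * real b ^ p\<rfloor> + 1) * b ^ (n - p)"
begin

text \<open>The terms are nonnegative, so the sum lies between those over a and a + 1 whole blocks,
  where a is the integer part of t b^p. The limits of the two block sums differ by b^-p times the
  constant, and p is arbitrary.\<close>

lemma partial_sum_limit:
  "(\<lambda>n. (\<Sum>j<c n. \<bar>S n j\<bar>) / (real b ^ n * sqrt n)) \<longlonglongrightarrow> t * sqrt (2 * v / pi)"
proof (rule tendstoI)
  fix e :: real assume e: "e > 0"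
  let ?L = "sqrt (2 * v / pi)"
  have L: "?L \<ge> 0" using v_nonneg by simp
  obtain p where p: "(?L + 1) / e < real b ^ p" using real_arch_pow[of "real b"] b2 by auto
  have bp: "real b ^ p > 0" using b_pos by simp
  have pe: "?L / real b ^ p < e"
  proof -
    have "?L < e * real b ^ p" using p e by (simp add: field_simps)
    then show ?thesis using bp by (simp add: field_simps)
  qed
  define a where "a = nat \<lfloor>t * real b ^ p\<rfloor>"
  have "real a = of_int \<lfloor>t * real b ^ p\<rfloor>" using t by (simp add: a_def)
  then have "real a \<le> t * real b ^ p" "t * real b ^ p < real a + 1" by linarith+
  then have a: "real a / real b ^ p \<le> t" "t \<le> real (a + 1) / real b ^ p" using bp by (simp_all add: field_simps)
  have lo: "t * ?L - e < real a / real b ^ p * ?L"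
  proof -
    have "t * ?L \<le> (real a / real b ^ p + 1 / real b ^ p) * ?L"
      using a(2) L by (intro mult_right_mono) (auto simp: add_divide_distrib)
    then show ?thesis using pe by (simp add: distrib_right)
  qed
  have hi: "real (a + 1) / real b ^ p * ?L < t * ?L + e"
  proof -
    have "(real a / real b ^ p + 1 / real b ^ p) * ?L \<le> (t + 1 / real b ^ p) * ?L"
      using a(1) L by (intro mult_right_mono) auto
    then show ?thesis using pe by (simp add: distrib_right add_divide_distrib)
  qed
  have "\<forall>\<^sub>F n in sequentially. t * ?L - e < (\<Sum>j<a * b ^ (n - p). \<bar>S n j\<bar>) / (real b ^ n * sqrt n)"
    using block_sum_limit lo by (rule order_tendstoD(1))
  moreover have "\<forall>\<^sub>F n in sequentially. (\<Sum>j<(a + 1) * b ^ (n - p). \<bar>S n j\<bar>) / (real b ^ n * sqrt n) < t * ?L + e"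
    using block_sum_limit hi by (rule order_tendstoD(2))
  ultimately show "\<forall>\<^sub>F n in sequentially. dist ((\<Sum>j<c n. \<bar>S n j\<bar>) / (real b ^ n * sqrt n)) (t * ?L) < e"
    using eventually_ge_at_top[of p]
  proof eventually_elim
    case (elim n)
    have "(\<Sum>j<a * b ^ (n - p). \<bar>S n j\<bar>) / (real b ^ n * sqrt n) \<le> (\<Sum>j<c n. \<bar>S n j\<bar>) / (real b ^ n * sqrt n)"
      using c_lower[OF elim(3)] by (intro divide_right_mono sum_mono2) (auto simp: a_def)
    moreover have "(\<Sum>j<c n. \<bar>S n j\<bar>) / (real b ^ n * sqrt n) \<le> (\<Sum>j<(a + 1) * b ^ (n - p). \<bar>S n j\<bar>) / (real b ^ n * sqrt n)"
      using c_upper[OF elim(3)] unfolding a_def[symmetric] by (intro divide_right_mono sum_mono2) auto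
    ultimately show ?case using elim unfolding dist_real_def by linarith
  qed
qed

text \<open>Theta replaces the linear factor 1 / sqrt (n ln b) by 1 / sqrt (n ln b - ln |S|). The
  second error term treats |S| >= 1, where 0 <= ln |S| <= ln (n K); the first treats |S| < 1, where
  the logarithm is unbounded but |S| is small. The hypothesis \<open>pos\<close> amounts to n K <
  b^n, so the argument of Theta is below 1.\<close>

lemma Theta_linearization:
  fixes n :: nat
  assumes n: "n > 0" and K: "K \<ge> M" "K \<ge> 1" and pos: "ln (real n * K) / real n < ln b"
  shows "\<bar>Theta (\<bar>S n j\<bar> / real b ^ n) - \<bar>S n j\<bar> / (real b ^ n * sqrt n) / sqrt (ln b)\<bar> \<le>
    (1 / sqrt (ln b) / sqrt n + \<bar>S n j\<bar> / sqrt n * (1 / sqrt (ln b - ln (real n * K) / real n) - 1 / sqrt (ln b))) / real b ^ n"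
proof -
  define s where "s = \<bar>S n j\<bar>"
  define d where "d = 1 / sqrt (ln b - ln (real n * K) / real n) - 1 / sqrt (ln b)"
  have lnb: "ln b > 0" using b2 by simp
  have nK: "real n * K \<ge> 1" using n K mult_mono[of 1 "real n" 1 K] by simp
  have lnK: "ln (real n * K) / real n \<ge> 0" using nK by simp
  have d: "d \<ge> 0" unfolding d_def using pos lnK lnb by (simp add: frac_le)
  have sK: "s \<le> real n * K" unfolding s_def using S_bound[of n j] mult_left_mono[OF K(1), of "real n"] by simp
  have bn: "real b ^ n > 0" using b_pos by simp
  have lin: "s / (real b ^ n * sqrt n) / sqrt (ln b) = s / real b ^ n * (1 / sqrt (real n * ln b))"
    by (simp add: real_sqrt_mult)
  have Theta: "Theta (s / real b ^ n) = s / real b ^ n * (1 / sqrt (real n * ln b - ln s))" if "s > 0"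
    using that bn by (simp add: Theta_def ln_div ln_realpow b_pos)
  have key: "\<bar>Theta (s / real b ^ n) - s / (real b ^ n * sqrt n) / sqrt (ln b)\<bar> \<le>
    (1 / sqrt (ln b) / sqrt n + s / sqrt n * d) / real b ^ n"
  proof -
    \<comment> \<open>For s < 1 the two factors are only known to lie between 0 and 1 / sqrt (n ln
      b). For s = 0 the separate value Theta 0 = 0 is used.\<close>
    consider "s = 0" | "0 < s" "s < 1" | "1 \<le> s" unfolding s_def by linarith
    then show ?thesis
    proof cases
      case 1
      then show ?thesis using lnb by (simp add: Theta_def)
    next
      case 2
      have ls: "ln s < 0" "0 < real n * ln b" using 2 n lnb by simp_all
      then have "0 \<le> 1 / sqrt (real n * ln b - ln s)" by simp
      moreover have "1 / sqrt (real n * ln b - ln s) \<le> 1 / sqrt (real n * ln b)"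
        using ls by (intro divide_left_mono) (auto intro!: mult_pos_pos)
      ultimately have "\<bar>1 / sqrt (real n * ln b - ln s) - 1 / sqrt (real n * ln b)\<bar> \<le> 1 / sqrt (real n * ln b)"
        by linarith
      then have "\<bar>s / real b ^ n * (1 / sqrt (real n * ln b - ln s)) - s / real b ^ n * (1 / sqrt (real n * ln b))\<bar> \<le>
          1 / real b ^ n * (1 / sqrt (real n * ln b))"
        unfolding right_diff_distrib[symmetric] abs_mult using 2 bn
        by (intro mult_mono) (auto simp: divide_right_mono)
      also have "\<dots> = 1 / sqrt (ln b) / sqrt n / real b ^ n" by (simp add: real_sqrt_mult)
      also have "\<dots> \<le> (1 / sqrt (ln b) / sqrt n + s / sqrt n * d) / real b ^ n"
        using d 2 bn by (intro divide_right_mono) auto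
      finally show ?thesis unfolding lin Theta[OF 2(1)] .
    next
      case 3
      let ?w = "real n * ln b - ln s"
      have ls: "0 \<le> ln s" "ln s \<le> ln (real n * K)" using 3 sK by auto
      have w: "real n * (ln b - ln (real n * K) / real n) \<le> ?w" using ls n by (simp add: field_simps)
      have w0: "0 < real n * (ln b - ln (real n * K) / real n)" using pos n by simp
      have "1 / sqrt ?w \<ge> 1 / sqrt (real n * ln b)"
        using w w0 ls by (intro divide_left_mono) auto
      moreover have "1 / sqrt ?w \<le> 1 / sqrt (real n * (ln b - ln (real n * K) / real n))"
        using w w0 by (intro divide_left_mono) auto
      moreover have "1 / sqrt (real n * (ln b - ln (real n * K) / real n)) - 1 / sqrt (real n * ln b) = d / sqrt n"
        by (simp add: d_def real_sqrt_mult diff_divide_distrib mult.commute)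
      ultimately have "\<bar>1 / sqrt ?w - 1 / sqrt (real n * ln b)\<bar> \<le> d / sqrt n" by linarith
      then have "\<bar>s / real b ^ n * (1 / sqrt ?w) - s / real b ^ n * (1 / sqrt (real n * ln b))\<bar> \<le>
          s / real b ^ n * (d / sqrt n)"
        unfolding right_diff_distrib[symmetric] abs_mult using 3 bn by (intro mult_mono) auto
      also have "\<dots> = (0 + s / sqrt n * d) / real b ^ n" by simp
      also have "\<dots> \<le> (1 / sqrt (ln b) / sqrt n + s / sqrt n * d) / real b ^ n"
        using lnb bn by (intro divide_right_mono add_right_mono) auto
      finally show ?thesis using 3 unfolding lin by (subst Theta) auto
    qed
  qed
  show ?thesis using key unfolding s_def d_def .
qed

text \<open>Summed over j, the first error is at most a constant times 1 / sqrt n, since the number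
  of summands is of order b^n; the second is the convergent normalised sum times a factor tending to
  0.\<close>

lemma Theta_sum_limit:
  "(\<lambda>n. \<Sum>j<c n. Theta (\<bar>S n j\<bar> / real b ^ n)) \<longlonglongrightarrow> t * sqrt (2 / (pi * ln b) * v)"
proof -
  define K where "K = M + 1"
  have K: "K \<ge> M" "K \<ge> 1" using M_nonneg by (auto simp: K_def)
  have lnb: "ln b > 0" using b2 by simp
  let ?W = "\<lambda>n. (\<Sum>j<c n. \<bar>S n j\<bar>) / (real b ^ n * sqrt n)"
  let ?d = "\<lambda>n. 1 / sqrt (ln b - ln (real n * K) / real n) - 1 / sqrt (ln b)"
  \<comment> \<open>This bounds \<open>c n / b ^ n\<close>, by the upper bound on c at the coarsest
    level p = 0.\<close>
  let ?C = "real (nat \<lfloor>t\<rfloor> + 1)"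
  have lnlim: "(\<lambda>n. ln (real n * K) / real n) \<longlonglongrightarrow> 0"
  proof -
    have "(\<lambda>n. ln (real n) / real n + ln K / real n) \<longlonglongrightarrow> 0 + 0"
      by (intro tendsto_add lim_const_over_n lim_ln_over_n)
    then have "(\<lambda>n. ln (real n) / real n + ln K / real n) \<longlonglongrightarrow> 0" by simp
    moreover have "\<forall>\<^sub>F n in sequentially. ln (real n) / real n + ln K / real n = ln (real n * K) / real n"
      using eventually_gt_at_top[of 0] K
      by (auto elim!: eventually_mono simp: ln_mult add_divide_distrib)
    ultimately show ?thesis by (rule Lim_transform_eventually)
  qed
  have "?d \<longlonglongrightarrow> 1 / sqrt (ln b - 0) - 1 / sqrt (ln b)"
    using lnb by (intro tendsto_intros lnlim) auto
  then have dlim: "?d \<longlonglongrightarrow> 0" by simp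
  have "(\<lambda>n. ?C * (1 / sqrt (ln b) / sqrt n) + ?W n * ?d n) \<longlonglongrightarrow> ?C * 0 + t * sqrt (2 * v / pi) * 0"
    by (intro tendsto_add tendsto_mult tendsto_const partial_sum_limit dlim
        tendsto_divide_0[OF tendsto_const filterlim_at_top_imp_at_infinity]
        filterlim_compose[OF sqrt_at_top filterlim_real_sequentially])
  then have err: "(\<lambda>n. ?C * (1 / sqrt (ln b) / sqrt n) + ?W n * ?d n) \<longlonglongrightarrow> 0" by simp
  have "\<forall>\<^sub>F n in sequentially. ln (real n * K) / real n < ln b"
    using lnlim lnb by (rule order_tendstoD(2))
  with eventually_gt_at_top[of 0]
  have "\<forall>\<^sub>F n in sequentially. norm ((\<Sum>j<c n. Theta (\<bar>S n j\<bar> / real b ^ n)) - ?W n / sqrt (ln b)) \<le>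
      ?C * (1 / sqrt (ln b) / sqrt n) + ?W n * ?d n"
  proof eventually_elim
    case (elim n)
    have bn: "real b ^ n > 0" using b_pos by simp
    have "?W n / sqrt (ln b) = (\<Sum>j<c n. \<bar>S n j\<bar> / (real b ^ n * sqrt n) / sqrt (ln b))"
      by (simp add: sum_divide_distrib)
    then have "norm ((\<Sum>j<c n. Theta (\<bar>S n j\<bar> / real b ^ n)) - ?W n / sqrt (ln b)) \<le>
       (\<Sum>j<c n. \<bar>Theta (\<bar>S n j\<bar> / real b ^ n) - \<bar>S n j\<bar> / (real b ^ n * sqrt n) / sqrt (ln b)\<bar>)"
      by (simp only: sum_subtractf[symmetric] real_norm_def sum_abs)
    also have "\<dots> \<le> (\<Sum>j<c n. (1 / sqrt (ln b) / sqrt n + \<bar>S n j\<bar> / sqrt n * ?d n) / real b ^ n)"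
      by (intro sum_mono Theta_linearization elim K)
    also have "\<dots> = real (c n) / real b ^ n * (1 / sqrt (ln b) / sqrt n) + ?W n * ?d n"
      by (simp add: sum_divide_distrib[symmetric] sum.distrib sum_distrib_right[symmetric] add_divide_distrib mult_ac)
    also have "\<dots> \<le> ?C * (1 / sqrt (ln b) / sqrt n) + ?W n * ?d n"
    proof -
      have "real (c n) \<le> ?C * real b ^ n"
      proof -
        have "c n \<le> (nat \<lfloor>t\<rfloor> + 1) * b ^ n" using c_upper[of 0 n] by simp
        then have "real (c n) \<le> real ((nat \<lfloor>t\<rfloor> + 1) * b ^ n)" by (simp only: of_nat_le_iff)
        then show ?thesis by (simp only: of_nat_mult of_nat_power)
      qed
      then have "real (c n) / real b ^ n \<le> ?C" using bn by (simp add: divide_le_eq)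
      then show ?thesis using lnb by (intro add_right_mono mult_right_mono) auto
    qed
    finally show ?case .
  qed
  from Lim_null_comparison[OF this err]
  have "(\<lambda>n. (\<Sum>j<c n. Theta (\<bar>S n j\<bar> / real b ^ n)) - ?W n / sqrt (ln b)) \<longlonglongrightarrow> 0" .
  moreover have "(\<lambda>n. ?W n / sqrt (ln b)) \<longlonglongrightarrow> t * sqrt (2 * v / pi) / sqrt (ln b)"
    using lnb by (intro tendsto_divide partial_sum_limit tendsto_const) auto
  ultimately have "(\<lambda>n. (\<Sum>j<c n. Theta (\<bar>S n j\<bar> / real b ^ n)) - ?W n / sqrt (ln b) + ?W n / sqrt (ln b)) \<longlonglongrightarrow>
      0 + t * sqrt (2 * v / pi) / sqrt (ln b)"
    by (rule tendsto_add)
  moreover have "t * sqrt (2 * v / pi) / sqrt (ln b) = t * sqrt (2 / (pi * ln b) * v)"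
  proof -
    have "sqrt (2 * v / pi) / sqrt (ln b) = sqrt (2 / (pi * ln b) * v)"
      by (simp add: real_sqrt_divide[symmetric])
    then show ?thesis by (metis times_divide_eq_right)
  qed
  ultimately show ?thesis by simp
qed

end

end

section \<open>Fourier coefficients and digit sums\<close>

lemma has_integral_cells:
  fixes f :: "real \<Rightarrow> 'a::banach"
  assumes N: "N > 0"
    and cell: "\<And>q. q < N \<Longrightarrow> (f has_integral I q) {real q / real N..(real q + 1) / real N}"
  shows "(f has_integral (\<Sum>q<N. I q)) {0..1}"
proof -
  have "(f has_integral (\<Sum>q<m. I q)) {0..real m / real N}" if "m \<le> N" for m
    using that
  proof (induction m)
    case 0 show ?case using has_integral_refl(2)[of f 0] by simp
  next
    case (Suc m)
    have "(f has_integral (\<Sum>q<m. I q) + I m) {0..(real m + 1) / real N}"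
      by (rule has_integral_combine[of 0 "real m / real N"])
        (use Suc N cell[of m] in \<open>auto simp: divide_right_mono\<close>)
    then show ?case by (simp add: add.commute)
  qed
  from this[of N] show ?thesis using N by simp
qed

section \<open>Continuous functions with vanishing Fourier coefficients\<close>

abbreviation trig :: "int \<Rightarrow> real \<Rightarrow> complex" where
  "trig j t \<equiv> exp (- 2 * complex_of_real pi * \<i> * of_int j * complex_of_real t)"

lemma trig_add: "trig (j + k) t = trig j t * trig k t"
  by (simp add: exp_add[symmetric] algebra_simps)

lemma cos_trig:
  "complex_of_real (cos (2 * pi * (t - x))) =
    (exp (2 * complex_of_real pi * \<i> * x) * trig 1 t + exp (- 2 * complex_of_real pi * \<i> * x) * trig (-1) t) / 2"
proof -
  have "complex_of_real (cos (2 * pi * (t - x))) = cos (complex_of_real (2 * pi * (t - x)))"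
    by (simp only: cos_of_real)
  also have "\<dots> = (exp (\<i> * complex_of_real (2 * pi * (t - x))) + exp (- (\<i> * complex_of_real (2 * pi * (t - x))))) / 2"
    by (simp add: cos_exp_eq)
  also have "\<dots> = (exp (2 * complex_of_real pi * \<i> * x) * trig 1 t + exp (- 2 * complex_of_real pi * \<i> * x) * trig (-1) t) / 2"
    by (simp add: exp_add[symmetric] algebra_simps)
  finally show ?thesis .
qed

text \<open>Multiplication by the cosine shifts the frequency j by 1 in both directions, so the
  induction on n has to treat all frequencies at once.\<close>

lemma trig_power_orthogonal:
  fixes \<psi> :: "real \<Rightarrow> real"
  assumes "\<And>j. ((\<lambda>t. complex_of_real (\<psi> t) * trig j t) has_integral 0) {0..1}"
  shows "((\<lambda>t. complex_of_real (\<psi> t * (\<kappa> + cos (2 * pi * (t - x))) ^ n) * trig j t) has_integral 0) {0..1}"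
proof (induction n arbitrary: j)
  case 0 show ?case using assms by simp
next
  case (Suc n)
  let ?f = "\<lambda>j t. complex_of_real (\<psi> t * (\<kappa> + cos (2 * pi * (t - x))) ^ n) * trig j t"
  let ?w = "exp (2 * complex_of_real pi * \<i> * x)" and ?w' = "exp (- 2 * complex_of_real pi * \<i> * x)"
  have "((\<lambda>t. complex_of_real \<kappa> * ?f j t + (?w / 2 * ?f (j + 1) t + ?w' / 2 * ?f (j + (-1)) t)) has_integral
    complex_of_real \<kappa> * 0 + (?w / 2 * 0 + ?w' / 2 * 0)) {0..1}"
    by (intro has_integral_add has_integral_mult_right Suc.IH)
  moreover have "complex_of_real \<kappa> * ?f j t + (?w / 2 * ?f (j + 1) t + ?w' / 2 * ?f (j + (-1)) t) =
    complex_of_real (\<psi> t * (\<kappa> + cos (2 * pi * (t - x))) ^ Suc n) * trig j t" for t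
  proof -
    have alg: "(K + (u * p + w * q) / 2) * (c * e) = K * (c * e) + (u / 2 * (c * (e * p)) + w / 2 * (c * (e * q)))"
      for K u p w q c e :: complex by (simp add: field_simps)
    have "complex_of_real (\<psi> t * (\<kappa> + cos (2 * pi * (t - x))) ^ Suc n) * trig j t =
       (complex_of_real \<kappa> + complex_of_real (cos (2 * pi * (t - x)))) * ?f j t"
      by simp
    also have "\<dots> = complex_of_real \<kappa> * ?f j t + (?w / 2 * ?f (j + 1) t + ?w' / 2 * ?f (j + (-1)) t)"
      unfolding trig_add cos_trig by (rule alg)
    finally show ?thesis ..
  qed
  ultimately show ?case by (simp only: mult_zero_right add_0_right)
qed

text \<open>The function cos (2 pi u) returns to its maximum at u = 1 and u = -1; a difference u of
  two points of [0,1] must therefore stay away from these values as well as from 0.\<close>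

lemma cos_le_cos_of_dist:
  assumes "0 \<le> \<delta>" "\<delta> \<le> \<bar>u\<bar>" "\<bar>u\<bar> \<le> 1 - \<delta>"
  shows "cos (2 * pi * u) \<le> cos (2 * pi * \<delta>)"
proof (cases "\<bar>u\<bar> \<le> 1 / 2")
  case True
  then have "cos (2 * pi * \<bar>u\<bar>) \<le> cos (2 * pi * \<delta>)"
    using assms by (intro cos_monotone_0_pi_le) auto
  then show ?thesis by (simp add: abs_if split: if_splits)
next
  case False
  then have "cos (2 * pi * (1 - \<bar>u\<bar>)) \<le> cos (2 * pi * \<delta>)"
    using assms by (intro cos_monotone_0_pi_le) auto
  moreover have "cos (2 * pi * (1 - \<bar>u\<bar>)) = cos (2 * pi * \<bar>u\<bar>)"
    by (simp add: right_diff_distrib cos_diff)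
  ultimately show ?thesis by (simp add: abs_if split: if_splits)
qed

text \<open>Powers of a trigonometric polynomial exceeding 1 only near x concentrate their mass
  there, so a nonzero value of the function at x would be detected.\<close>

lemma fourier_vanishing_le:
  fixes \<psi> :: "real \<Rightarrow> real"
  assumes cont: "continuous_on {0..1} \<psi>" and x: "x \<in> {0<..<1}"
    and zero: "\<And>j. ((\<lambda>t. complex_of_real (\<psi> t) * trig j t) has_integral 0) {0..1}"
  shows "\<psi> x \<le> 0"
proof (rule ccontr)
  assume "\<not> \<psi> x \<le> 0"
  define c where "c = \<psi> x / 2"
  have c: "c > 0" using \<open>\<not> \<psi> x \<le> 0\<close> by (simp add: c_def)
  obtain d where d: "d > 0" "\<And>t. t \<in> {0..1} \<Longrightarrow> dist t x < d \<Longrightarrow> dist (\<psi> t) (\<psi> x) < c"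
    using cont x c unfolding continuous_on_iff by (metis atLeastAtMost_iff greaterThanLessThan_iff less_imp_le)
  \<comment> \<open>The bound d / 2 keeps \<psi> above c within distance \<delta> of x, 1/4 makes
    cos (2 pi \<delta>) nonnegative, and the distances of x to 0 and 1 keep the neighbourhood inside
    [0,1] and the differences t - x away from 1 and -1.\<close>
  define \<delta> where "\<delta> = min (min (d / 2) (1 / 4)) (min x (1 - x))"
  have \<delta>: "\<delta> > 0" "\<delta> < d" "\<delta> \<le> x" "\<delta> \<le> 1 - x" "\<delta> \<le> 1 / 4"
    using d(1) x unfolding \<delta>_def by (auto simp: min_def)
  have low: "c \<le> \<psi> t" if "\<bar>t - x\<bar> \<le> \<delta>" for t
    using d(2)[of t] that \<delta> unfolding dist_real_def c_def by (auto simp: abs_if split: if_splits)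
  obtain B where B: "\<And>t. t \<in> {0..1} \<Longrightarrow> \<bar>\<psi> t\<bar> \<le> B"
    using compact_imp_bounded[OF compact_continuous_image[OF cont compact_Icc]]
    unfolding bounded_iff by (metis image_eqI real_norm_def)
  have B0: "B \<ge> 0" using B[of 0] by simp
  \<comment> \<open>With this shift \<open>?q\<close> equals 1 at distance \<delta> from x, is at
    least Q > 1 within distance \<delta> / 2, and has absolute value at most 1 farther away than
    \<delta>.\<close>
  define \<kappa> where "\<kappa> = 1 - cos (2 * pi * \<delta>)"
  let ?q = "\<lambda>t. \<kappa> + cos (2 * pi * (t - x))"
  define Q where "Q = \<kappa> + cos (2 * pi * (\<delta> / 2))"
  have Q: "Q > 1" using \<delta> cos_monotone_0_pi[of "2 * pi * (\<delta> / 2)" "2 * pi * \<delta>"]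
    by (simp add: Q_def \<kappa>_def)
  have "0 \<le> cos (2 * pi * \<delta>)"
  proof (rule cos_ge_zero)
    have "0 \<le> 2 * pi * \<delta>" using \<delta> by simp
    then show "- (pi / 2) \<le> 2 * pi * \<delta>" using pi_gt_zero by linarith
    show "2 * pi * \<delta> \<le> pi / 2" using \<delta> by simp
  qed
  then have \<kappa>: "0 \<le> \<kappa>" "\<kappa> \<le> 1" by (auto simp: \<kappa>_def)
  have q_far: "\<bar>?q t\<bar> \<le> 1" if "t \<in> {0..1}" "\<bar>t - x\<bar> > \<delta>" for t
  proof -
    have "cos (2 * pi * (t - x)) \<le> cos (2 * pi * \<delta>)"
      using that \<delta> x by (intro cos_le_cos_of_dist) auto
    moreover have "cos (2 * pi * (t - x)) \<ge> -1" by simp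
    ultimately show ?thesis using \<kappa> unfolding \<kappa>_def abs_le_iff by linarith
  qed
  have cosnear: "cos (2 * pi * h) \<le> cos (2 * pi * (t - x))" if "\<bar>t - x\<bar> \<le> h" "h \<le> \<delta>" for t h
  proof -
    have "cos (2 * pi * h) \<le> cos (2 * pi * \<bar>t - x\<bar>)"
      using that \<delta> by (intro cos_monotone_0_pi_le) auto
    also have "cos (2 * pi * \<bar>t - x\<bar>) = cos (2 * pi * (t - x))"
      using cos_minus[of "2 * pi * (t - x)"] by (cases "t \<ge> x") (simp_all add: algebra_simps)
    finally show ?thesis .
  qed
  have bound: "c * Q ^ n * \<delta> \<le> B" for n
  proof -
    \<comment> \<open>A step function below \<psi> q^n + B, whose integral is B. Its own integral is
      c Q^n \<delta>, which would have to stay bounded as n grows.\<close>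
    let ?g = "\<lambda>t. if t \<in> {x - \<delta> / 2..x + \<delta> / 2} then c * Q ^ n else 0"
    have C: "((\<lambda>t. complex_of_real (\<psi> t * ?q t ^ n)) has_integral 0) {0..1}"
      using trig_power_orthogonal[OF zero, of \<kappa> x n 0] by simp
    have I: "((\<lambda>t. \<psi> t * ?q t ^ n) has_integral 0) {0..1}"
      using has_integral_linear[OF C bounded_linear_Re] by (simp only: o_def Re_complex_of_real zero_complex.sel)
    have "((\<lambda>t. c * Q ^ n) has_integral (x + \<delta> / 2 - (x - \<delta> / 2)) *\<^sub>R (c * Q ^ n)) {x - \<delta> / 2..x + \<delta> / 2}"
      using \<delta> by (intro has_integral_const_real[THEN has_integral_eq_rhs]) auto
    then have "(?g has_integral (x + \<delta> / 2 - (x - \<delta> / 2)) *\<^sub>R (c * Q ^ n)) {0..1}"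
      using \<delta> has_integral_restrict_closed_subintervals_eq[of "x - \<delta> / 2" "x + \<delta> / 2" 0 1]
      by (subst has_integral_restrict) auto
    moreover have "((\<lambda>t. \<psi> t * ?q t ^ n + B) has_integral 0 + B) {0..1}"
      using has_integral_const_real[of B 0 1] by (intro has_integral_add I) auto
    moreover have "?g t \<le> \<psi> t * ?q t ^ n + B" if t: "t \<in> {0..1}" for t
    proof -
      consider "\<bar>t - x\<bar> \<le> \<delta> / 2" | "\<bar>t - x\<bar> > \<delta> / 2" "\<bar>t - x\<bar> \<le> \<delta>" | "\<bar>t - x\<bar> > \<delta>" by linarith
      then show ?thesis
      proof cases
        case 1
        then have "c * Q ^ n \<le> \<psi> t * ?q t ^ n"
          using low[of t] cosnear[of t "\<delta> / 2"] \<delta> Q c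
          by (intro mult_mono power_mono) (auto simp: Q_def)
        moreover have "0 \<le> c * Q ^ n" using c Q by simp
        ultimately show ?thesis using B0 by simp
      next
        case 2
        have "0 \<le> \<psi> t" using low[of t] 2 c by auto
        moreover have "0 \<le> ?q t" using cosnear[of t \<delta>] 2 by (simp add: \<kappa>_def)
        ultimately have "0 \<le> \<psi> t * ?q t ^ n" by simp
        moreover have "?g t = 0" using 2 by (auto simp: abs_if split: if_splits)
        ultimately show ?thesis using B0 by linarith
      next
        case 3
        have "\<bar>\<psi> t * ?q t ^ n\<bar> \<le> B * 1 ^ n" unfolding abs_mult power_abs
          using 3 t \<delta> by (intro mult_mono power_mono q_far B) (auto simp: B0)
        moreover have "?g t = 0" using 3 \<delta> by (auto simp: abs_if split: if_splits)
        ultimately show ?thesis by simp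
      qed
    qed
    ultimately have "(x + \<delta> / 2 - (x - \<delta> / 2)) *\<^sub>R (c * Q ^ n) \<le> 0 + B"
      by (rule has_integral_le) auto
    then show ?thesis by (simp add: mult.commute)
  qed
  obtain n where "B / (c * \<delta>) < Q ^ n" using real_arch_pow[OF Q] by blast
  then have "B < c * Q ^ n * \<delta>" using c \<delta> by (simp add: field_simps)
  then show False using bound[of n] by simp
qed

text \<open>The one-sided result applies to \<psi> and to its negative in the open interval;
  continuity settles the endpoints.\<close>

lemma fourier_vanishing:
  fixes \<psi> :: "real \<Rightarrow> real"
  assumes cont: "continuous_on {0..1} \<psi>" and x: "x \<in> {0..1}"
    and zero: "\<And>j. ((\<lambda>t. complex_of_real (\<psi> t) * trig j t) has_integral 0) {0..1}"
  shows "\<psi> x = 0"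
proof -
  have "\<psi> y = 0" if "y \<in> {0<..<1}" for y
  proof -
    have "((\<lambda>t. complex_of_real (- \<psi> t) * trig j t) has_integral 0) {0..1}" for j
      using has_integral_neg[OF zero[of j]] by simp
    from fourier_vanishing_le[OF _ that this] fourier_vanishing_le[OF cont that zero] cont
    show ?thesis by (simp add: continuous_on_minus)
  qed
  then show ?thesis
    using continuous_constant_on_closure[of "{0<..<1}" \<psi> 0 x] cont x by simp
qed

text \<open>The substitution t = (x + i) / b on each of the b cells shows that the j-th Fourier
  coefficient of the digit sum is b times the (j b)-th coefficient of \<phi>. By (H3) only the mean
  survives, and a continuous function all of whose other coefficients vanish is constant.\<close>

lemma digit_sum_constant:
  fixes \<phi> :: "real \<Rightarrow> real"
  assumes b: "b > 0" and cont: "continuous_on {0..1} \<phi>"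
    and zero: "\<And>j::int. j \<noteq> 0 \<Longrightarrow> integral {0..1} (\<lambda>t. complex_of_real (\<phi> t) * trig (j * int b) t) = 0"
  obtains C where "\<And>x. x \<in> {0..1} \<Longrightarrow> (\<Sum>i<b. \<phi> ((x + real i) / real b)) = C"
proof -
  let ?\<psi> = "\<lambda>x. \<Sum>i<b. \<phi> ((x + real i) / real b)"
  have cell: "(x + real i) / real b \<in> {0..1}" if "x \<in> {0..1}" "i < b" for x i
  proof -
    have "real i + 1 \<le> real b" using that by simp
    then show ?thesis using that b by (simp add: field_simps)
  qed
  have cont\<psi>: "continuous_on {0..1} ?\<psi>"
    by (intro continuous_intros continuous_on_compose2[OF cont]) (use b cell in auto)
  have coeff: "((\<lambda>x. complex_of_real (?\<psi> x) * trig j x) has_integral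
      of_nat b * integral {0..1} (\<lambda>t. complex_of_real (\<phi> t) * trig (j * int b) t)) {0..1}" for j
  proof -
    let ?f = "\<lambda>t. complex_of_real (\<phi> t) * trig (j * int b) t"
    let ?I = "\<lambda>i. integral {real i / real b..(real i + 1) / real b} ?f"
    have fint: "?f integrable_on {0..1}"
      by (intro integrable_continuous_real continuous_intros cont)
    have fi: "(?f has_integral ?I i) {real i / real b..(real i + 1) / real b}" if "i < b" for i
    proof (rule integrable_integral, rule integrable_on_subinterval[OF fint])
      show "{real i / real b..(real i + 1) / real b} \<subseteq> {0..1}"
        using cell[of 0 i] cell[of 1 i] that by (auto simp: add.commute)
    qed
    have "(?f has_integral (\<Sum>i<b. ?I i)) {0..1}" by (rule has_integral_cells[OF b fi])
    then have total: "integral {0..1} ?f = (\<Sum>i<b. ?I i)" by (rule integral_unique)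
    have "((\<lambda>x. complex_of_real (\<phi> ((x + real i) / real b)) * trig j x) has_integral of_nat b * ?I i) {0..1}"
      if "i < b" for i
    proof -
      have "((\<lambda>x. ?f ((1 / real b) *\<^sub>R x + real i / real b)) has_integral
          (1 / (\<bar>1 / real b\<bar> ^ DIM(real))) *\<^sub>R ?I i)
          ((\<lambda>x. (1 / (1 / real b)) *\<^sub>R x + - ((1 / (1 / real b)) *\<^sub>R (real i / real b))) ` cbox (real i / real b) ((real i + 1) / real b))"
        using fi[OF that] b by (intro has_integral_affinity) (auto simp: cbox_interval)
      moreover have "(\<lambda>x. (1 / (1 / real b)) *\<^sub>R x + - ((1 / (1 / real b)) *\<^sub>R (real i / real b))) ` cbox (real i / real b) ((real i + 1) / real b) = {0..1}"
        using b image_affinity_atLeastAtMost[of "real b" "- real i" "real i / real b" "(real i + 1) / real b"]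
        by (simp add: cbox_interval divide_right_mono)
      moreover have "?f ((1 / real b) *\<^sub>R x + real i / real b) = complex_of_real (\<phi> ((x + real i) / real b)) * trig j x" for x
      proof -
        \<comment> \<open>The shift by i / b at frequency j b contributes exp (- 2 pi i) to the
          integer power j * i, which is 1.\<close>
        have "trig (j * int b) ((x + real i) / real b) = trig j x * exp (2 * of_int (- j * int i) * complex_of_real pi * \<i>)"
          unfolding exp_add[symmetric] using b by (intro arg_cong[of _ _ exp]) (simp add: field_simps)
        also have "exp (2 * of_int (- j * int i) * complex_of_real pi * \<i>) = 1"
          using exp_integer_2pi[of "of_int (- j * int i)"] by simp
        finally show ?thesis using b by (simp add: add_divide_distrib)
      qed
      ultimately show ?thesis using b by (simp add: scaleR_conv_of_real)
    qed
    then have "((\<lambda>x. \<Sum>i<b. complex_of_real (\<phi> ((x + real i) / real b)) * trig j x) has_integral (\<Sum>i<b. of_nat b * ?I i)) {0..1}"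
      by (intro has_integral_sum) auto
    then show ?thesis unfolding total by (simp add: sum_distrib_left sum_distrib_right)
  qed
  \<comment> \<open>The mean of the digit sum over [0,1], that is, its coefficient of frequency
    0.\<close>
  define C where "C = real b * integral {0..1} \<phi>"
  have C: "((\<lambda>x. ?\<psi> x) has_integral C) {0..1}"
  proof -
    have "((\<lambda>x. Re (complex_of_real (?\<psi> x))) has_integral Re (of_nat b * integral {0..1} (\<lambda>t. complex_of_real (\<phi> t)))) {0..1}"
      using has_integral_linear[OF coeff[of 0] bounded_linear_Re] by (simp add: o_def)
    moreover have "integral {0..1} (\<lambda>t. complex_of_real (\<phi> t)) = of_real (integral {0..1} \<phi>)"
      using integral_linear[OF integrable_continuous_real[OF cont] bounded_linear_of_real[where 'a=complex]]
      by (simp add: o_def)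
    ultimately show ?thesis by (simp add: C_def)
  qed
  have "?\<psi> x - C = 0" if x: "x \<in> {0..1}" for x
  proof (rule fourier_vanishing[of "\<lambda>x. ?\<psi> x - C", OF _ x])
    show "continuous_on {0..1} (\<lambda>x. ?\<psi> x - C)" by (intro continuous_on_diff cont\<psi> continuous_on_const)
    fix j :: int
    have trig_int: "(trig j has_integral 0) {0..1}" if "j \<noteq> 0"
    proof -
      let ?c = "- 2 * complex_of_real pi * \<i> * of_int j"
      have nz: "?c \<noteq> 0" using that by simp
      have "((\<lambda>t. trig j t) has_integral exp (?c * complex_of_real 1) / ?c - exp (?c * complex_of_real 0) / ?c) {0..1}"
      proof (rule fundamental_theorem_of_calculus)
        fix t :: real
        show "((\<lambda>t. exp (?c * complex_of_real t) / ?c) has_vector_derivative trig j t) (at t within {0..1})"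
          using nz by (auto intro!: derivative_eq_intros has_vector_derivative_real_field simp: field_simps)
      qed simp
      moreover have "exp (?c * complex_of_real 1) = exp (2 * of_int (- j) * complex_of_real pi * \<i>)"
        by (simp add: algebra_simps)
      ultimately show ?thesis using exp_integer_2pi[of "of_int (- j)"] by simp
    qed
    show "((\<lambda>t. complex_of_real (?\<psi> t - C) * trig j t) has_integral 0) {0..1}"
    proof (cases "j = 0")
      case True
      have "((\<lambda>x. ?\<psi> x - C) has_integral C - C) {0..1}"
        using has_integral_const_real[of C 0 1] by (intro has_integral_diff C) auto
      from has_integral_linear[OF this bounded_linear_of_real[where 'a=complex]] True
      show ?thesis by (simp add: o_def)
    next
      case False
      have "((\<lambda>t. complex_of_real (?\<psi> t) * trig j t - complex_of_real C * trig j t) has_integral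
         of_nat b * 0 - complex_of_real C * 0) {0..1}"
        using coeff[of j] zero[OF False] trig_int[OF False]
        by (intro has_integral_diff has_integral_mult_right) auto
      then show ?thesis by (simp add: left_diff_distrib)
    qed
  qed
  then show ?thesis using that[of C] by simp
qed

section \<open>Slopes of piecewise continuously differentiable functions\<close>

lemma tendsto_locally_bounded:
  fixes g :: "real \<Rightarrow> real"
  assumes "(g \<longlongrightarrow> l) (at x within S)"
  shows "\<exists>e>0. \<exists>B. \<forall>y\<in>S. y \<noteq> x \<and> dist y x < e \<longrightarrow> \<bar>g y\<bar> \<le> B"
proof -
  have "eventually (\<lambda>y. dist (g y) l < 1) (at x within S)"
    using tendstoD[OF assms, of 1] by simp
  then obtain e where "e > 0" "\<forall>y\<in>S. y \<noteq> x \<and> dist y x < e \<longrightarrow> dist (g y) l < 1"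
    unfolding eventually_at by auto
  then have "\<forall>y\<in>S. y \<noteq> x \<and> dist y x < e \<longrightarrow> \<bar>g y\<bar> \<le> \<bar>l\<bar> + 1"
    unfolding dist_real_def by (smt (verit))
  with \<open>e > 0\<close> show ?thesis by blast
qed

lemma locally_bounded_imp_bounded:
  fixes g :: "real \<Rightarrow> real"
  assumes loc: "\<And>x. x \<in> K \<Longrightarrow> \<exists>e>0. \<exists>B. \<forall>y\<in>A. dist y x < e \<longrightarrow> \<bar>g y\<bar> \<le> B"
    and K: "compact K" and AK: "A \<subseteq> K"
  shows "\<exists>B\<ge>0. \<forall>y\<in>A. \<bar>g y\<bar> \<le> B"
proof -
  obtain e B where eB: "\<And>x. x \<in> K \<Longrightarrow> e x > 0"
    "\<And>x y. x \<in> K \<Longrightarrow> y \<in> A \<Longrightarrow> dist y x < e x \<Longrightarrow> \<bar>g y\<bar> \<le> B x"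
    using loc by metis
  have "K \<subseteq> (\<Union>x\<in>K. ball x (e x))" using eB(1) by force
  then obtain C where C: "C \<subseteq> K" "finite C" "K \<subseteq> (\<Union>x\<in>C. ball x (e x))"
    using compactE_image[OF K, of K "\<lambda>x. ball x (e x)"] by auto
  let ?B = "\<Sum>x\<in>C. \<bar>B x\<bar>"
  have "\<bar>g y\<bar> \<le> ?B" if yA: "y \<in> A" for y
  proof -
    obtain x where x: "x \<in> C" "y \<in> ball x (e x)" using C(3) AK yA by blast
    then have "\<bar>g y\<bar> \<le> B x" using eB(2)[of x y] C(1) yA by (auto simp: dist_commute)
    also have "\<dots> \<le> \<bar>B x\<bar>" by simp
    also have "\<dots> \<le> ?B" using x C(2) by (intro member_le_sum) auto
    finally show ?thesis .
  qed
  then show ?thesis by (intro exI[of _ ?B]) (simp add: sum_nonneg)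
qed

text \<open>A one-sided limit bounds the derivative on that side of every point of [0,1]: at
  exceptional points and endpoints it is assumed, elsewhere it follows from continuity. Compactness
  makes the bound global.\<close>

lemma piecewise_cont_differentiable_bounded:
  assumes "piecewise_cont_differentiable \<phi>"
  obtains T B where "finite T" "B \<ge> 0"
    "\<And>x. x \<in> {0<..<1} - T \<Longrightarrow> \<phi> differentiable (at x)"
    "\<And>x. x \<in> {0<..<1} - T \<Longrightarrow> isCont (deriv \<phi>) x"
    "\<And>x. x \<in> {0<..<1} - T \<Longrightarrow> \<bar>deriv \<phi> x\<bar> \<le> B"
proof -
  obtain T where T: "finite T" "T \<subseteq> {0<..<1}"
    "\<And>x. x \<in> {0<..<1} - T \<Longrightarrow> \<phi> differentiable (at x)"
    and cont: "continuous_on ({0<..<1} - T) (deriv \<phi>)"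
    and lim: "\<And>t. t \<in> T \<Longrightarrow> (\<exists>l. (deriv \<phi> \<longlongrightarrow> l) (at_left t)) \<and> (\<exists>r. (deriv \<phi> \<longlongrightarrow> r) (at_right t))"
      "\<exists>r. (deriv \<phi> \<longlongrightarrow> r) (at_right 0)" "\<exists>l. (deriv \<phi> \<longlongrightarrow> l) (at_left 1)"
    using assms unfolding piecewise_cont_differentiable_def by blast
  have "open ({0<..<1} - T)" using T(1) by (intro open_Diff finite_imp_closed) auto
  then have isCont: "isCont (deriv \<phi>) x" if "x \<in> {0<..<1} - T" for x
    using cont that by (simp add: continuous_on_eq_continuous_at)
  have loc: "\<exists>e>0. \<exists>B. \<forall>y\<in>{0<..<1} - T. dist y x < e \<longrightarrow> \<bar>deriv \<phi> y\<bar> \<le> B" if x: "x \<in> {0..1}" for x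
  proof -
    have left: "\<exists>e>0. \<exists>B. \<forall>y\<in>{0<..<1}. y < x \<and> dist y x < e \<longrightarrow> \<bar>deriv \<phi> y\<bar> \<le> B"
    proof (cases "x = 0")
      case True then show ?thesis by (intro exI[of _ 1]) auto
    next
      case False
      then have "\<exists>l. (deriv \<phi> \<longlongrightarrow> l) (at_left x)"
        using x lim isCont[of x] by (cases "x = 1"; cases "x \<in> T") (auto simp: isCont_def filterlim_at_split)
      then obtain l where "(deriv \<phi> \<longlongrightarrow> l) (at x within {..<x})" by blast
      from tendsto_locally_bounded[OF this] show ?thesis by (metis lessThan_iff less_irrefl)
    qed
    have right: "\<exists>e>0. \<exists>B. \<forall>y\<in>{0<..<1}. y > x \<and> dist y x < e \<longrightarrow> \<bar>deriv \<phi> y\<bar> \<le> B"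
    proof (cases "x = 1")
      case True then show ?thesis by (intro exI[of _ 1]) auto
    next
      case False
      then have "\<exists>l. (deriv \<phi> \<longlongrightarrow> l) (at_right x)"
        using x lim isCont[of x] by (cases "x = 0"; cases "x \<in> T") (auto simp: isCont_def filterlim_at_split)
      then obtain l where "(deriv \<phi> \<longlongrightarrow> l) (at x within {x<..})" by blast
      from tendsto_locally_bounded[OF this] show ?thesis by (metis greaterThan_iff less_irrefl)
    qed
    obtain e1 B1 e2 B2 where "e1 > 0" "e2 > 0"
      and l: "\<And>y. y \<in> {0<..<1} \<Longrightarrow> y < x \<Longrightarrow> dist y x < e1 \<Longrightarrow> \<bar>deriv \<phi> y\<bar> \<le> B1"
      and r: "\<And>y. y \<in> {0<..<1} \<Longrightarrow> y > x \<Longrightarrow> dist y x < e2 \<Longrightarrow> \<bar>deriv \<phi> y\<bar> \<le> B2"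
      using left right by metis
    \<comment> \<open>The one-sided bounds say nothing about the point x itself, hence its own value
      in the maximum.\<close>
    have "\<bar>deriv \<phi> y\<bar> \<le> max \<bar>deriv \<phi> x\<bar> (max B1 B2)" if "y \<in> {0<..<1} - T" "dist y x < min e1 e2" for y
      using l[of y] r[of y] that by (cases y x rule: linorder_cases) (auto simp: le_max_iff_disj)
    with \<open>e1 > 0\<close> \<open>e2 > 0\<close> show ?thesis
      by (intro exI[of _ "min e1 e2"] conjI exI[of _ "max \<bar>deriv \<phi> x\<bar> (max B1 B2)"]) auto
  qed
  have "{0<..<1} - T \<subseteq> {0..1}" by auto
  from locally_bounded_imp_bounded[OF loc compact_Icc this]
  obtain B where "B \<ge> 0" "\<forall>y\<in>{0<..<1} - T. \<bar>deriv \<phi> y\<bar> \<le> B" by blast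
  with that T isCont show ?thesis by blast
qed

text \<open>Continuity lets the fundamental theorem of calculus cross the finitely many exceptional
  points.\<close>

lemma bounded_deriv_imp_lipschitz:
  fixes \<phi> :: "real \<Rightarrow> real"
  assumes cont: "continuous_on {0..1} \<phi>" and T: "finite T" and B: "B \<ge> 0"
    and diff: "\<And>x. x \<in> {0<..<1} - T \<Longrightarrow> \<phi> differentiable (at x)"
    and bound: "\<And>x. x \<in> {0<..<1} - T \<Longrightarrow> \<bar>deriv \<phi> x\<bar> \<le> B"
    and uv: "0 \<le> u" "u \<le> v" "v \<le> 1"
  shows "\<bar>\<phi> v - \<phi> u\<bar> \<le> B * (v - u)"
proof -
  have "(deriv \<phi> has_integral (\<phi> v - \<phi> u)) {u..v}"
  proof (rule fundamental_theorem_of_calculus_interior_strong[OF T uv(2)])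
    show "(\<phi> has_vector_derivative deriv \<phi> x) (at x)" if "x \<in> {u<..<v} - T" for x
      using diff[of x] that uv
      by (auto simp: has_real_derivative_iff_has_vector_derivative[symmetric] DERIV_deriv_iff_real_differentiable)
    show "continuous_on {u..v} \<phi>" using cont uv by (auto intro: continuous_on_subset)
  qed
  from has_integral_bound_real[OF B _ this, of "T \<union> {0, 1}"] show ?thesis
    using T uv bound by auto
qed

text \<open>Instead of a point, each cell carries a nondegenerate subinterval over which a slope is
  taken. In the application it is usually much shorter than the cell, and the fixed low digits
  determine its position.\<close>

definition cell_tags :: "nat \<Rightarrow> (nat \<Rightarrow> real) \<Rightarrow> (nat \<Rightarrow> real) \<Rightarrow> bool" where
  "cell_tags N u v \<longleftrightarrow> (\<forall>q<N. real q / real N \<le> u q \<and> u q < v q \<and> v q \<le> (real q + 1) / real N)"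

text \<open>The sum is the integral of a step function. Off the exceptional points the mean value
  theorem makes the steps converge pointwise to the squared derivative, and the Lipschitz constant
  dominates them, so dominated convergence applies despite the jumps of the derivative.\<close>

lemma slope_square_sum_tendsto:
  fixes \<phi> :: "real \<Rightarrow> real"
  assumes T: "finite T"
    and diff: "\<And>x. x \<in> {0<..<1} - T \<Longrightarrow> \<phi> differentiable (at x)"
    and cont: "\<And>x. x \<in> {0<..<1} - T \<Longrightarrow> isCont (deriv \<phi>) x"
    and lip: "\<And>u v. 0 \<le> u \<Longrightarrow> u \<le> v \<Longrightarrow> v \<le> 1 \<Longrightarrow> \<bar>\<phi> v - \<phi> u\<bar> \<le> B * (v - u)"
    and tags: "\<And>k. cell_tags (Suc k) (U k) (V k)"
  shows "(\<lambda>k. (\<Sum>q<Suc k. ((\<phi> (V k q) - \<phi> (U k q)) / (V k q - U k q))\<^sup>2 / real (Suc k))) \<longlonglongrightarrow>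
    integral {0..1} (\<lambda>x. (deriv \<phi> x)\<^sup>2)"
proof -
  let ?G = "{0<..<1} - T"
  define D where "D k q = ((\<phi> (V k q) - \<phi> (U k q)) / (V k q - U k q))\<^sup>2" for k q
  define f where "f k x = (if x \<in> ?G then D k (nat \<lfloor>x * real (Suc k)\<rfloor>) else 0)" for k x
  define g where "g x = (if x \<in> ?G then (deriv \<phi> x)\<^sup>2 else 0)" for x
  have cell_index: "nat \<lfloor>x * real N\<rfloor> = q" if "real q / real N < x" "x < (real q + 1) / real N" "N > 0" for x q N
    using that by (intro nat_eq_iff[THEN iffD2] disjI1) (auto simp: field_simps intro!: floor_unique)
  have index_cell: "nat \<lfloor>x * real N\<rfloor> < N \<and> real (nat \<lfloor>x * real N\<rfloor>) / real N \<le> x \<and> x < (real (nat \<lfloor>x * real N\<rfloor>) + 1) / real N"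
    if "0 < x" "x < 1" "N > 0" for x :: real and N :: nat
  proof -
    have nonneg: "0 \<le> x * real N" using that by simp
    then have r: "real (nat \<lfloor>x * real N\<rfloor>) = of_int \<lfloor>x * real N\<rfloor>" by simp
    have "x * real N < real N" using that by simp
    then have "\<lfloor>x * real N\<rfloor> < int N" by (simp add: floor_less_iff)
    then have "nat \<lfloor>x * real N\<rfloor> < N" using nonneg by linarith
    moreover have "of_int \<lfloor>x * real N\<rfloor> \<le> x * real N" "x * real N < of_int \<lfloor>x * real N\<rfloor> + 1" by linarith+
    ultimately show ?thesis unfolding r using that by (simp add: field_simps)
  qed
  have fint: "(f k has_integral (\<Sum>q<Suc k. D k q / real (Suc k))) {0..1}" for k
  proof (rule has_integral_cells)
    fix q assume q: "q < Suc k"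
    let ?a = "real q / real (Suc k)" and ?b = "(real q + 1) / real (Suc k)"
    have ab: "0 \<le> ?a" "?a \<le> ?b" "?b \<le> 1" using q by (auto simp: divide_right_mono)
    have "((\<lambda>x. D k q) has_integral D k q / real (Suc k)) {?a..?b}"
      using has_integral_const_real[of "D k q" ?a ?b] ab by (simp add: diff_divide_distrib[symmetric])
    then show "(f k has_integral D k q / real (Suc k)) {?a..?b}"
    proof (rule has_integral_spike_finite[rotated 2])
      show "finite (T \<union> {?a, ?b})" using T by simp
      fix x assume "x \<in> {?a..?b} - (T \<union> {?a, ?b})"
      then have x: "?a < x" "x < ?b" "x \<notin> T" by auto
      then have "0 < x" "x < 1" using ab by linarith+
      then have "x \<in> ?G" using x by simp
      then show "f k x = D k q" using cell_index[OF x(1,2)] by (simp add: f_def del: of_nat_Suc)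
    qed
  qed simp
  have slope: "\<bar>(\<phi> (V k q) - \<phi> (U k q)) / (V k q - U k q)\<bar> \<le> B" if "q < Suc k" for k q
  proof -
    have uv: "real q / real (Suc k) \<le> U k q" "U k q < V k q" "V k q \<le> (real q + 1) / real (Suc k)"
      using tags[of k] that unfolding cell_tags_def by auto
    moreover have "0 \<le> real q / real (Suc k)" by simp
    moreover have "(real q + 1) / real (Suc k) \<le> 1" using that by simp
    ultimately have "\<bar>\<phi> (V k q) - \<phi> (U k q)\<bar> \<le> B * (V k q - U k q)" by (intro lip) linarith+
    then show ?thesis using uv by (simp add: abs_divide divide_le_eq)
  qed
  have lim: "(\<lambda>k. f k x) \<longlonglongrightarrow> g x" for x
  proof (cases "x \<in> ?G")
    case False
    then show ?thesis by (auto simp: f_def g_def)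
  next
    case True
    define qq where "qq k = nat \<lfloor>x * real (Suc k)\<rfloor>" for k
    let ?s = "\<lambda>k. (\<phi> (V k (qq k)) - \<phi> (U k (qq k))) / (V k (qq k) - U k (qq k))"
    have "?s \<longlonglongrightarrow> deriv \<phi> x"
    proof (rule tendstoI)
      fix e :: real assume e: "e > 0"
      obtain d1 where d1: "d1 > 0" "\<And>y. dist y x < d1 \<Longrightarrow> dist (deriv \<phi> y) (deriv \<phi> x) < e"
        using cont[OF True] e unfolding continuous_at_eps_delta by (auto simp: dist_real_def)
      have "open ?G" using T by (intro open_Diff finite_imp_closed) auto
      then obtain d2 where d2: "d2 > 0" "\<And>y. dist y x < d2 \<Longrightarrow> y \<in> ?G"
        using True unfolding open_dist by blast
      define d where "d = min d1 d2"
      have d: "d > 0" using d1 d2 by (simp add: d_def)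
      have "(\<lambda>k. 1 / real (Suc k)) \<longlonglongrightarrow> 0" using LIMSEQ_inverse_real_of_nat by (simp add: inverse_eq_divide)
      then have "\<forall>\<^sub>F k in sequentially. 1 / real (Suc k) < d" using d by (rule order_tendstoD(2))
      then show "\<forall>\<^sub>F k in sequentially. dist (?s k) (deriv \<phi> x) < e"
      proof eventually_elim
        case (elim k)
        let ?u = "U k (qq k)" and ?v = "V k (qq k)"
        have c: "qq k < Suc k" "real (qq k) / real (Suc k) \<le> x" "x < (real (qq k) + 1) / real (Suc k)"
          using index_cell[of x "Suc k"] True unfolding qq_def by auto
        have uv: "real (qq k) / real (Suc k) \<le> ?u" "?u < ?v" "?v \<le> (real (qq k) + 1) / real (Suc k)"
          using tags[of k] c(1) unfolding cell_tags_def by auto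
        have near: "dist y x < d" if "?u \<le> y" "y \<le> ?v" for y
          using c(2,3) uv that elim unfolding dist_real_def add_divide_distrib by linarith
        \<comment> \<open>The whole cell around x is shorter than d, so the subinterval stays where
          \<phi> is differentiable and the intermediate point z is within d of x.\<close>
        have "\<exists>l z. ?u < z \<and> z < ?v \<and> DERIV \<phi> z :> l \<and> \<phi> ?v - \<phi> ?u = (?v - ?u) * l"
        proof (rule MVT[OF uv(2)])
          have G: "y \<in> ?G" if "?u \<le> y" "y \<le> ?v" for y
            using near[OF that] d2(2) unfolding d_def by simp
          show "continuous_on {?u..?v} \<phi>"
            by (intro continuous_at_imp_continuous_on ballI differentiable_imp_continuous_within diff G) auto
          show "\<phi> differentiable (at y)" if "?u < y" "y < ?v" for y
            using diff G that by simp
        qed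
        then obtain l z where z: "?u < z" "z < ?v" "DERIV \<phi> z :> l" "\<phi> ?v - \<phi> ?u = (?v - ?u) * l" by blast
        have "?s k = deriv \<phi> z" using z uv(2) DERIV_imp_deriv[OF z(3)] by simp
        moreover have "dist z x < d1" using near[of z] z unfolding d_def by simp
        ultimately show ?case using d1(2) by simp
      qed
    qed
    then have "(\<lambda>k. (?s k)\<^sup>2) \<longlonglongrightarrow> (deriv \<phi> x)\<^sup>2" by (rule tendsto_power)
    then show ?thesis using True by (simp add: f_def g_def D_def qq_def)
  qed
  have le: "norm (f k x) \<le> B\<^sup>2" for k x
  proof (cases "x \<in> ?G")
    case True
    then have "nat \<lfloor>x * real (Suc k)\<rfloor> < Suc k" using index_cell[of x "Suc k"] by simp
    from power_mono[OF slope[OF this] abs_ge_zero, of 2]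
    show ?thesis using True by (simp add: f_def D_def del: of_nat_Suc abs_divide)
  qed (auto simp: f_def)
  have "(\<lambda>k. integral {0..1} (f k)) \<longlonglongrightarrow> integral {0..1} g"
    using fint le lim by (intro dominated_convergence(2)[where h = "\<lambda>_. B\<^sup>2"]) (auto simp: integrable_on_def)
  moreover have "integral {0..1} (f k) = (\<Sum>q<Suc k. D k q / real (Suc k))" for k
    using fint by (rule integral_unique)
  moreover have "integral {0..1} g = integral {0..1} (\<lambda>x. (deriv \<phi> x)\<^sup>2)"
    using T by (intro integral_spike[of "T \<union> {0, 1}"]) (auto simp: g_def)
  ultimately show ?thesis by (simp only: D_def)
qed

text \<open>Uniformity over the choice of the subintervals is obtained by contradiction, applying
  the sequential version to a sequence of bad choices.\<close>

lemma slope_square_sum_uniform: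
  fixes \<phi> :: "real \<Rightarrow> real"
  assumes T: "finite T"
    and diff: "\<And>x. x \<in> {0<..<1} - T \<Longrightarrow> \<phi> differentiable (at x)"
    and cont: "\<And>x. x \<in> {0<..<1} - T \<Longrightarrow> isCont (deriv \<phi>) x"
    and lip: "\<And>u v. 0 \<le> u \<Longrightarrow> u \<le> v \<Longrightarrow> v \<le> 1 \<Longrightarrow> \<bar>\<phi> v - \<phi> u\<bar> \<le> B * (v - u)"
    and e: "e > 0"
  shows "\<exists>R. \<forall>N\<ge>R. \<forall>u v. cell_tags N u v \<longrightarrow>
    \<bar>(\<Sum>q<N. ((\<phi> (v q) - \<phi> (u q)) / (v q - u q))\<^sup>2 / real N) - integral {0..1} (\<lambda>x. (deriv \<phi> x)\<^sup>2)\<bar> \<le> e"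
proof -
  let ?err = "\<lambda>N u v. \<bar>(\<Sum>q<N. ((\<phi> (v q) - \<phi> (u q)) / (v q - u q))\<^sup>2 / real N) - integral {0..1} (\<lambda>x. (deriv \<phi> x)\<^sup>2)\<bar>"
  define bad where "bad N u v \<longleftrightarrow> cell_tags N u v \<and> ?err N u v > e" for N u v
  \<comment> \<open>W k is a bad choice whenever one exists; otherwise the full cells serve as a
    default, so that the sequence is admissible for every k.\<close>
  have "\<forall>k. \<exists>w. cell_tags (Suc k) (fst w) (snd w) \<and> (\<forall>u v. bad (Suc k) u v \<longrightarrow> bad (Suc k) (fst w) (snd w))"
  proof
    fix k
    show "\<exists>w. cell_tags (Suc k) (fst w) (snd w) \<and> (\<forall>u v. bad (Suc k) u v \<longrightarrow> bad (Suc k) (fst w) (snd w))"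
    proof (cases "\<exists>u v. bad (Suc k) u v")
      case True
      then obtain u v where "bad (Suc k) u v" by blast
      then show ?thesis by (intro exI[of _ "(u, v)"]) (simp add: bad_def)
    next
      case False
      have "cell_tags (Suc k) (\<lambda>q. real q / real (Suc k)) (\<lambda>q. (real q + 1) / real (Suc k))"
        unfolding cell_tags_def by (simp add: divide_strict_right_mono)
      with False show ?thesis
        by (intro exI[of _ "(\<lambda>q. real q / real (Suc k), \<lambda>q. (real q + 1) / real (Suc k))"]) simp
    qed
  qed
  from choice[OF this] obtain W where
    W: "\<And>k. cell_tags (Suc k) (fst (W k)) (snd (W k))"
      "\<And>k u v. bad (Suc k) u v \<Longrightarrow> bad (Suc k) (fst (W k)) (snd (W k))" by blast
  have "\<forall>\<^sub>F k in sequentially. ?err (Suc k) (fst (W k)) (snd (W k)) < e"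
    using tendstoD[OF slope_square_sum_tendsto[OF T diff cont lip W(1)] e] by (simp only: dist_real_def)
  then obtain R where R: "\<And>k. k \<ge> R \<Longrightarrow> ?err (Suc k) (fst (W k)) (snd (W k)) < e"
    unfolding eventually_sequentially by blast
  have "?err N u v \<le> e" if N: "N \<ge> Suc R" and tags: "cell_tags N u v" for N u v
  proof (rule ccontr)
    assume "\<not> ?err N u v \<le> e"
    moreover obtain k where k: "N = Suc k" "k \<ge> R" using N by (cases N) auto
    ultimately have "bad (Suc k) u v" using tags by (simp only: bad_def not_le k(1))
    then have "bad (Suc k) (fst (W k)) (snd (W k))" by (rule W(2))
    then show False using R[OF k(2)] unfolding bad_def by linarith
  qed
  then show ?thesis by blast
qed

section \<open>Takagi-type functions\<close>

lemma periodic_add_nat: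
  fixes \<phi> :: "real \<Rightarrow> 'a"
  assumes "\<And>t. \<phi> (t + 1) = \<phi> t"
  shows "\<phi> (t + real n) = \<phi> t"
proof (induction n)
  case (Suc n)
  then show ?case using assms[of "t + real n"] by (simp add: add_ac)
qed simp

lemma periodic_add_int:
  fixes \<phi> :: "real \<Rightarrow> 'a"
  assumes "\<And>t. \<phi> (t + 1) = \<phi> t"
  shows "\<phi> (t + of_int k) = \<phi> t"
proof (cases k rule: int_cases2)
  case (nonneg n)
  then show ?thesis using periodic_add_nat[of \<phi> t n] assms by simp
next
  case (nonpos n)
  then show ?thesis using periodic_add_nat[of \<phi> "t - real n" n] assms by simp
qed

definition adic_slope :: "(real \<Rightarrow> real) \<Rightarrow> nat \<Rightarrow> nat \<Rightarrow> nat \<Rightarrow> real" where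
  "adic_slope \<phi> b k j = real b ^ k * (\<phi> ((real j + 1) / real b ^ k) - \<phi> (real j / real b ^ k))"

lemma adic_slope_periodic:
  assumes per: "\<And>t. \<phi> (t + 1) = \<phi> t" and b: "b > 0"
  shows "adic_slope \<phi> b k (j + b ^ k * q) = adic_slope \<phi> b k j"
proof -
  have "\<phi> ((x + real (b ^ k * q)) / real b ^ k) = \<phi> (x / real b ^ k)" for x
    using periodic_add_nat[of \<phi> "x / real b ^ k" q, OF per] b by (simp add: add_divide_distrib)
  from this[of "real j"] this[of "real j + 1"] show ?thesis by (simp add: adic_slope_def add_ac)
qed

text \<open>The martingale property says that the digit sum takes equal values at a / b^k and (a +
  1) / b^k. For fixed low digits a, the squares of level k + r form a tagged sum over b^r cells;
  since the convergence is uniform in the tags, R does not depend on k or a.\<close>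

lemma adic_martingale_adic_slope:
  fixes b :: nat and \<phi> :: "real \<Rightarrow> real"
  assumes b: "b \<ge> 2" and per: "\<And>t. \<phi> (t + 1) = \<phi> t"
    and cont: "continuous_on UNIV \<phi>" and pw: "piecewise_cont_differentiable \<phi>"
    and fourier: "\<And>j::int. j \<noteq> 0 \<Longrightarrow> integral {0..1} (\<lambda>t. complex_of_real (\<phi> t) * trig (j * int b) t) = 0"
  shows "\<exists>M. adic_martingale b (adic_slope \<phi> b) M (integral {0..1} (\<lambda>x. (deriv \<phi> x)\<^sup>2))"
proof -
  have b0: "b > 0" and b1: "real b \<ge> 1" using b by auto
  have cont01: "continuous_on {0..1} \<phi>" using cont by (rule continuous_on_subset) simp
  obtain T B where T: "finite T" "B \<ge> 0"
    and diff: "\<And>x. x \<in> {0<..<1} - T \<Longrightarrow> \<phi> differentiable (at x)"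
    and isCont: "\<And>x. x \<in> {0<..<1} - T \<Longrightarrow> isCont (deriv \<phi>) x"
    and bound: "\<And>x. x \<in> {0<..<1} - T \<Longrightarrow> \<bar>deriv \<phi> x\<bar> \<le> B"
    using piecewise_cont_differentiable_bounded[OF pw] by blast
  have lip: "\<bar>\<phi> v - \<phi> u\<bar> \<le> B * (v - u)" if "0 \<le> u" "u \<le> v" "v \<le> 1" for u v
    using bounded_deriv_imp_lipschitz[OF cont01 T diff bound] that by blast
  obtain C where C: "\<And>x. x \<in> {0..1} \<Longrightarrow> (\<Sum>i<b. \<phi> ((x + real i) / real b)) = C"
    using digit_sum_constant[OF b0 cont01 fourier] by blast
  note slope_periodic = adic_slope_periodic[of \<phi>, OF per b0]
  have "adic_martingale b (adic_slope \<phi> b) B (integral {0..1} (\<lambda>x. (deriv \<phi> x)\<^sup>2))"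
  proof
    show "b > 0" by (rule b0)
    show "adic_slope \<phi> b k (j + b ^ k * q) = adic_slope \<phi> b k j" for k j q by (rule slope_periodic)
    show "\<bar>adic_slope \<phi> b k j\<bar> \<le> B" for k j
    proof -
      \<comment> \<open>Reduction to the lowest k digits moves the interval into [0,1], where the
        Lipschitz bound holds.\<close>
      let ?r = "j mod b ^ k"
      have bk: "real b ^ k > 0" using b0 by simp
      have "?r < b ^ k" using b0 by simp
      then have r: "real ?r + 1 \<le> real b ^ k" by (metis Suc_leI of_nat_Suc of_nat_le_iff of_nat_power add.commute)
      have "adic_slope \<phi> b k j = adic_slope \<phi> b k ?r"
        using slope_periodic[of k ?r "j div b ^ k"] by simp
      moreover have "\<bar>\<phi> ((real ?r + 1) / real b ^ k) - \<phi> (real ?r / real b ^ k)\<bar> \<le> B * (1 / real b ^ k)"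
        using lip[of "real ?r / real b ^ k" "(real ?r + 1) / real b ^ k"] bk r
        by (simp add: divide_right_mono diff_divide_distrib[symmetric])
      then have "\<bar>adic_slope \<phi> b k ?r\<bar> \<le> real b ^ k * (B * (1 / real b ^ k))"
        unfolding adic_slope_def abs_mult using bk by (intro mult_mono) auto
      ultimately show ?thesis using b0 by simp
    qed
    show "(\<Sum>q<b. adic_slope \<phi> b (Suc k) (a + b ^ k * q)) = 0" if a: "a < b ^ k" for a k
    proof -
      have bk: "real b ^ k > 0" using b0 by simp
      have a': "real a + 1 \<le> real b ^ k" using a by (metis Suc_leI of_nat_Suc of_nat_le_iff of_nat_power add.commute)
      have arg: "(y + real (b ^ k * q)) / real b ^ Suc k = (y / real b ^ k + real q) / real b" for y q
        using bk b0 by (simp add: field_simps)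
      have "(\<Sum>q<b. adic_slope \<phi> b (Suc k) (a + b ^ k * q)) =
        real b ^ Suc k * ((\<Sum>q<b. \<phi> (((real a + 1) / real b ^ k + real q) / real b)) -
          (\<Sum>q<b. \<phi> ((real a / real b ^ k + real q) / real b)))"
        unfolding adic_slope_def sum_distrib_left[symmetric] sum_subtractf arg[symmetric] by (simp add: add_ac)
      also have "\<dots> = 0" using C[of "(real a + 1) / real b ^ k"] C[of "real a / real b ^ k"] a a' bk by simp
      finally show ?thesis .
    qed
    fix \<epsilon> :: real assume \<epsilon>: "\<epsilon> > 0"
    obtain R where R: "\<And>N u v. N \<ge> R \<Longrightarrow> cell_tags N u v \<Longrightarrow>
      \<bar>(\<Sum>q<N. ((\<phi> (v q) - \<phi> (u q)) / (v q - u q))\<^sup>2 / real N) - integral {0..1} (\<lambda>x. (deriv \<phi> x)\<^sup>2)\<bar> \<le> \<epsilon>"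
      using slope_square_sum_uniform[OF T(1) diff isCont lip \<epsilon>] by blast
    show "\<exists>R. \<forall>k. \<forall>r\<ge>R. \<forall>a<b ^ k.
        \<bar>avg (b ^ r) (\<lambda>q. (adic_slope \<phi> b (k + r) (a + b ^ k * q))\<^sup>2) - integral {0..1} (\<lambda>x. (deriv \<phi> x)\<^sup>2)\<bar> \<le> \<epsilon>"
    proof (intro exI[of _ R] allI impI)
      fix k r a assume r: "R \<le> r" and a: "a < b ^ k"
      let ?n = "real b ^ (k + r)"
      define u where "u q = (real a + real b ^ k * real q) / ?n" for q
      define v where "v q = (real a + real b ^ k * real q + 1) / ?n" for q
      have n: "?n > 0" and bk: "real b ^ k > 0" using b0 by auto
      have a': "real a + 1 \<le> real b ^ k" using a by (metis Suc_leI of_nat_Suc of_nat_le_iff of_nat_power add.commute)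
      have tags: "cell_tags (b ^ r) u v"
        unfolding cell_tags_def
      proof (intro allI impI conjI)
        fix q
        have "real q / real (b ^ r) = real b ^ k * real q / ?n" using b0 by (simp add: power_add)
        also have "\<dots> \<le> u q" unfolding u_def using n by (intro divide_right_mono) auto
        finally show "real q / real (b ^ r) \<le> u q" .
        show "u q < v q" unfolding u_def v_def using n by (intro divide_strict_right_mono) auto
        have "v q \<le> (real b ^ k * (real q + 1)) / ?n"
          unfolding v_def using n a' by (intro divide_right_mono) (auto simp: distrib_left)
        also have "\<dots> = (real q + 1) / real (b ^ r)" using b0 by (simp add: power_add)
        finally show "v q \<le> (real q + 1) / real (b ^ r)" .
      qed
      \<comment> \<open>The same R serves for the number of levels, because r < 2^r <= b^r.\<close>
      have N: "b ^ r \<ge> R"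
        using r less_exp[of r] power_mono[OF b, of r] by linarith
      have eq: "(\<Sum>q<b ^ r. ((\<phi> (v q) - \<phi> (u q)) / (v q - u q))\<^sup>2 / real (b ^ r)) =
          avg (b ^ r) (\<lambda>q. (adic_slope \<phi> b (k + r) (a + b ^ k * q))\<^sup>2)"
      proof -
        have "v q - u q = 1 / ?n" for q
          unfolding u_def v_def by (simp add: diff_divide_distrib[symmetric])
        then have "(\<phi> (v q) - \<phi> (u q)) / (v q - u q) = adic_slope \<phi> b (k + r) (a + b ^ k * q)" for q
          by (simp add: adic_slope_def u_def v_def mult.commute)
        then show ?thesis by (simp add: avg_def sum_divide_distrib)
      qed
      show "\<bar>avg (b ^ r) (\<lambda>q. (adic_slope \<phi> b (k + r) (a + b ^ k * q))\<^sup>2) -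
          integral {0..1} (\<lambda>x. (deriv \<phi> x)\<^sup>2)\<bar> \<le> \<epsilon>"
        using R[OF N tags] unfolding eq .
    qed
  qed
  then show ?thesis ..
qed

text \<open>For m >= n the argument b^m j / b^n is an integer, so the series stops. The reversal m =
  n - (k + 1) indexes the terms by the number of low digits of j on which they depend.\<close>

lemma takagi_type_adic:
  fixes \<phi> :: "real \<Rightarrow> real"
  assumes zero: "\<And>k::int. \<phi> (of_int k) = 0" and b: "b > 0"
  shows "takagi_type b \<phi> (real j / real b ^ n) = (\<Sum>k<n. real b ^ Suc k * \<phi> (real j / real b ^ Suc k)) / real b ^ n"
proof -
  have "takagi_type b \<phi> (real j / real b ^ n) = (\<Sum>m<n. \<phi> (real b ^ m * (real j / real b ^ n)) / real b ^ m)"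
    unfolding takagi_type_def
  proof (rule suminf_finite)
    fix m assume "m \<notin> {..<n}"
    then have "real b ^ m = real b ^ (m - n) * real b ^ n" by (simp add: power_add[symmetric])
    then have "real b ^ m * (real j / real b ^ n) = of_int (int (b ^ (m - n) * j))"
      using b by simp
    then show "\<phi> (real b ^ m * (real j / real b ^ n)) / real b ^ m = 0"
      by (simp only: zero div_0)
  qed simp
  also have "\<dots> = (\<Sum>k<n. \<phi> (real b ^ (n - Suc k) * (real j / real b ^ n)) / real b ^ (n - Suc k))"
    by (rule sum.nat_diff_reindex[symmetric])
  also have "\<dots> = (\<Sum>k<n. real b ^ Suc k * \<phi> (real j / real b ^ Suc k) / real b ^ n)"
  proof (rule sum.cong[OF refl])
    fix k assume "k \<in> {..<n}"
    then have "real b ^ n = real b ^ (n - Suc k) * real b ^ Suc k"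
      by (simp only: power_add[symmetric]) simp
    then show "\<phi> (real b ^ (n - Suc k) * (real j / real b ^ n)) / real b ^ (n - Suc k) =
        real b ^ Suc k * \<phi> (real j / real b ^ Suc k) / real b ^ n"
      using b by simp
  qed
  finally show ?thesis by (simp only: sum_divide_distrib)
qed

lemma takagi_type_increment:
  fixes \<phi> :: "real \<Rightarrow> real"
  assumes "\<And>k::int. \<phi> (of_int k) = 0" and "b > 0"
  shows "takagi_type b \<phi> ((real j + 1) / real b ^ n) - takagi_type b \<phi> (real j / real b ^ n) =
    (\<Sum>k<n. adic_slope \<phi> b (Suc k) j) / real b ^ n"
  using takagi_type_adic[of \<phi> b "Suc j" n, OF assms] takagi_type_adic[of \<phi> b j n, OF assms]
  by (simp only: adic_slope_def right_diff_distrib sum_subtractf diff_divide_distrib of_nat_Suc add.commute)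

text \<open>Periodicity extends the bound of \<phi> on [0,1] to the whole line, which gives a
  geometric majorant of the series.\<close>

lemma continuous_on_takagi_type:
  fixes \<phi> :: "real \<Rightarrow> real"
  assumes b: "b \<ge> 2" and per: "\<And>t. \<phi> (t + 1) = \<phi> t" and cont: "continuous_on UNIV \<phi>"
  shows "continuous_on A (takagi_type b \<phi>)"
proof -
  have "continuous_on {0..1} \<phi>" using cont by (rule continuous_on_subset) simp
  from compact_imp_bounded[OF compact_continuous_image[OF this compact_Icc]]
  obtain B where B: "\<And>t. t \<in> {0..1} \<Longrightarrow> \<bar>\<phi> t\<bar> \<le> B"
    unfolding bounded_iff by (metis image_eqI real_norm_def)
  have bound: "\<bar>\<phi> t\<bar> \<le> B" for t
    using B[of "frac t"] periodic_add_int[of \<phi> "frac t" "\<lfloor>t\<rfloor>", OF per]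
      frac_lt_1[of t] frac_ge_0[of t]
    by (simp add: frac_def)
  have "uniform_limit A (\<lambda>n t. \<Sum>m<n. \<phi> (real b ^ m * t) / real b ^ m)
      (\<lambda>t. \<Sum>m. \<phi> (real b ^ m * t) / real b ^ m) sequentially"
  proof (rule Weierstrass_m_test)
    show "norm (\<phi> (real b ^ m * t) / real b ^ m) \<le> B * (1 / real b) ^ m" for m t
      using divide_right_mono[OF bound[of "real b ^ m * t"], of "real b ^ m"] by (simp add: power_one_over abs_divide)
    show "summable (\<lambda>m. B * (1 / real b) ^ m)"
      using b by (intro summable_mult summable_geometric) simp
  qed
  then show ?thesis
    unfolding takagi_type_def[abs_def]
  proof (rule uniform_limit_theorem[rotated])
    show "\<forall>\<^sub>F n in sequentially. continuous_on A (\<lambda>t. \<Sum>m<n. \<phi> (real b ^ m * t) / real b ^ m)"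
      using b by (intro always_eventually allI continuous_intros continuous_on_compose2[OF cont]) auto
  qed simp
qed

lemma floor_power_bounds:
  fixes b :: nat and t :: real
  assumes b: "b > 0" and t: "0 \<le> t" and pn: "p \<le> n"
  shows "nat \<lfloor>t * real b ^ p\<rfloor> * b ^ (n - p) \<le> nat \<lfloor>t * real b ^ n\<rfloor>"
    and "nat \<lfloor>t * real b ^ n\<rfloor> < (nat \<lfloor>t * real b ^ p\<rfloor> + 1) * b ^ (n - p)"
proof -
  let ?f = "\<lambda>p. nat \<lfloor>t * real b ^ p\<rfloor>"
  have f: "real (?f p) \<le> t * real b ^ p" "t * real b ^ p < real (?f p) + 1" for p
  proof -
    have "real (?f p) = of_int \<lfloor>t * real b ^ p\<rfloor>" using t by simp
    then show "real (?f p) \<le> t * real b ^ p" "t * real b ^ p < real (?f p) + 1" by linarith+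
  qed
  have bn: "real b ^ n = real b ^ p * real b ^ (n - p)" using pn by (simp add: power_add[symmetric])
  have bp: "real b ^ (n - p) > 0" using b by simp
  have "real (?f p * b ^ (n - p)) \<le> t * real b ^ n"
    using mult_right_mono[OF f(1)[of p], of "real b ^ (n - p)"] bp by (simp add: bn mult.assoc)
  then have "real (?f p * b ^ (n - p)) < real (?f n) + 1" using f(2)[of n] by linarith
  then show "?f p * b ^ (n - p) \<le> ?f n" by linarith
  have "t * real b ^ n < (real (?f p) + 1) * real b ^ (n - p)"
    using mult_strict_right_mono[OF f(2)[of p] bp] by (simp add: bn mult.assoc)
  then have "real (?f n) < (real (?f p) + 1) * real b ^ (n - p)" using f(1)[of n] by linarith
  also have "\<dots> = real ((?f p + 1) * b ^ (n - p))" by (simp only: of_nat_mult of_nat_power of_nat_add of_nat_1)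
  finally have "real (?f n) < real ((?f p + 1) * b ^ (n - p))" .
  then show "?f n < (?f p + 1) * b ^ (n - p)" by (simp only: of_nat_less_iff)
qed

text \<open>The cap b^n discards the index j = b^n, which occurs only for t = 1; the increment there
  lies in the constant extension and contributes Theta 0 = 0.\<close>

lemma variation_sum_eq:
  assumes b: "b > 0" and t: "t \<in> {0..1}"
  shows "variation_sum Theta b f n t =
    (\<Sum>j<min (nat \<lfloor>t * real b ^ n\<rfloor> + 1) (b ^ n). Theta \<bar>f ((real j + 1) / real b ^ n) - f (real j / real b ^ n)\<bar>)"
proof -
  let ?c = "nat \<lfloor>t * real b ^ n\<rfloor>"
  let ?g = "\<lambda>j. Theta \<bar>extend_const f ((real j + 1) / real b ^ n) - extend_const f (real j / real b ^ n)\<bar>"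
  have bn: "real b ^ n > 0" using b by simp
  have "variation_sum Theta b f n t = (\<Sum>j<?c + 1. ?g j)"
    unfolding variation_sum_def by (rule sum.cong) auto
  also have "\<dots> = (\<Sum>j<min (?c + 1) (b ^ n). ?g j)"
  proof (rule sum.mono_neutral_right)
    show "\<forall>j\<in>{..<?c + 1} - {..<min (?c + 1) (b ^ n)}. ?g j = 0"
    proof
      fix j assume "j \<in> {..<?c + 1} - {..<min (?c + 1) (b ^ n)}"
      then have "real b ^ n \<le> real j" by (metis Diff_iff lessThan_iff min_less_iff_conj not_le of_nat_le_iff of_nat_power)
      then have "real b ^ n \<le> real j" "real b ^ n < real j + 1" by linarith+
      then have "1 \<le> real j / real b ^ n" "1 < (real j + 1) / real b ^ n"
        using bn by simp_all
      then show "?g j = 0" by (auto simp: extend_const_def Theta_def)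
    qed
  qed auto
  also have "\<dots> = (\<Sum>j<min (?c + 1) (b ^ n). Theta \<bar>f ((real j + 1) / real b ^ n) - f (real j / real b ^ n)\<bar>)"
  proof (rule sum.cong[OF refl])
    fix j assume "j \<in> {..<min (?c + 1) (b ^ n)}"
    then have "j + 1 \<le> b ^ n" by simp
    then have "real j + 1 \<le> real b ^ n" by (metis of_nat_1 of_nat_add of_nat_le_iff of_nat_power)
    moreover from this have "real j \<le> real b ^ n" by linarith
    ultimately have "(real j + 1) / real b ^ n \<le> 1" "real j / real b ^ n \<le> 1" using bn by (simp_all only: divide_le_eq_1_pos)
    then show "?g j = Theta \<bar>f ((real j + 1) / real b ^ n) - f (real j / real b ^ n)\<bar>"
      by (simp add: extend_const_def)
  qed
  finally show ?thesis .
qed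

theorem theorem2p5:
  fixes b :: nat and \<phi> :: "real \<Rightarrow> real"
  assumes "b \<ge> 2"
    and "\<And>t. \<phi> (t + 1) = \<phi> t"
    and "\<And>k::int. \<phi> (of_int k) = 0"
    and "continuous_on UNIV \<phi>"
    and "piecewise_cont_differentiable \<phi>"
    and "\<And>j::int. j \<noteq> 0 \<Longrightarrow>
      integral {0..1} (\<lambda>t. complex_of_real (\<phi> t) *
        exp (- 2 * complex_of_real pi * \<i> * of_int j * of_nat b * complex_of_real t)) = 0"
  shows "is_continuous_variation Theta b (takagi_type b \<phi>)
    (\<lambda>t. t * sqrt (2 / (pi * ln (real b)) * integral {0..1} (\<lambda>x. (deriv \<phi> x)\<^sup>2)))"
proof -
  let ?v = "integral {0..1} (\<lambda>x. (deriv \<phi> x)\<^sup>2)"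
  have b0: "b > 0" using assms(1) by simp
  have "integral {0..1} (\<lambda>t. complex_of_real (\<phi> t) * trig (j * int b) t) = 0" if "j \<noteq> 0" for j
    using assms(6)[OF that] by (simp add: mult.assoc)
  then obtain M where "adic_martingale b (adic_slope \<phi> b) M ?v"
    using adic_martingale_adic_slope[OF assms(1,2,4,5)] by blast
  then interpret adic_martingale b "adic_slope \<phi> b" M ?v .
  have lim: "(\<lambda>n. variation_sum Theta b (takagi_type b \<phi>) n t) \<longlonglongrightarrow> t * sqrt (2 / (pi * ln (real b)) * ?v)"
    if t: "t \<in> {0..1}" for t
  proof -
    define c where "c n = min (nat \<lfloor>t * real b ^ n\<rfloor> + 1) (b ^ n)" for n
    have "(\<lambda>n. \<Sum>j<c n. Theta (\<bar>S n j\<bar> / real b ^ n)) \<longlonglongrightarrow> t * sqrt (2 / (pi * ln (real b)) * ?v)"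
    proof (rule Theta_sum_limit[where c = c])
      show "0 \<le> t" "b \<ge> 2" using t assms(1) by auto
      fix p n :: nat assume pn: "p \<le> n"
      note fl = floor_power_bounds[OF b0 _ pn, of t]
      have "nat \<lfloor>t * real b ^ p\<rfloor> \<le> b ^ p"
      proof -
        have "t * real b ^ p \<le> real (b ^ p)" using t mult_right_mono[of t 1 "real b ^ p"] by simp
        then show ?thesis by linarith
      qed
      \<comment> \<open>Because of the cap in c, the lower estimate must be checked against b^n as
        well as against the floor.\<close>
      then have "nat \<lfloor>t * real b ^ p\<rfloor> * b ^ (n - p) \<le> b ^ p * b ^ (n - p)" by (rule mult_right_mono) simp
      also have "\<dots> = b ^ n" using pn by (simp add: power_add[symmetric])
      finally show "nat \<lfloor>t * real b ^ p\<rfloor> * b ^ (n - p) \<le> c n" using fl(1) t by (simp add: c_def)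
      show "c n \<le> (nat \<lfloor>t * real b ^ p\<rfloor> + 1) * b ^ (n - p)" using fl(2) t by (simp add: c_def)
    qed
    moreover have "variation_sum Theta b (takagi_type b \<phi>) n t = (\<Sum>j<c n. Theta (\<bar>S n j\<bar> / real b ^ n))" for n
      unfolding variation_sum_eq[OF b0 t] c_def S_def takagi_type_increment[of \<phi>, OF assms(3) b0]
      by (simp add: abs_divide)
    ultimately show ?thesis by simp
  qed
  have "0 \<le> 2 / (pi * ln (real b)) * ?v" using v_nonneg assms(1) by simp
  then show ?thesis
    unfolding is_continuous_variation_def
    using lim continuous_on_takagi_type[of b \<phi>, OF assms(1,2,4)]
    by (auto intro!: continuous_intros)
qed

end
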